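(* Let $V$ be an irreducible $\tau$-module with finite-dimensional weight spaces with respect to $\underline{\mathfrak h}=\mathring{\mathfrak h}\oplus\mathcal Z_0\oplus D$, where $\mathcal Z_0=\mathrm{span}(K_1,\dots,K_n)$. Let $L=\{\underline r,-\underline r:\ t^{\underline r}K_i\neq0\text{ on }V\text{ for some }i\}$ and let $k$ be the dimension of the $\mathbb C$-linear span of $L$. Then there is $B\in GL(n,\mathbb Z)$ such that the twisted module $V^{\sigma_B}$ satisfies: (1) there exist non-zero integers $m_1,\dots,m_k$ and non-zero central operators $z_1,\dots,z_k$ on it with $\deg z_i=(0,\dots,0,m_i,0,\dots,0)$ ($m_i$ in the $i$-th place); (2) $k<n$; (3) $t^{\underline r}K_i$ acts as $0$ for all $i$ and all $\underline r$ with $r_j\neq0$ for some $k+1\le j\le n$; (4) $t^{\underline r}K_i$ acts as $0$ for all $1\le i\le k$ and all $\underline r$; (5) there is a proper subspace $W$ which is a submodule for the subalgebra $\mathring{\mathfrak g}\otimes A\oplus\mathcal Z\oplus D_k$, $D_k=\mathrm{span}(d_{k+1},\dots,d_n)$, such that $V/W$ has finite-dimensional weight spaces with respect to $\mathring{\mathfrak h}\oplus\mathcal Z_0\oplus D_k$.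
   Context: Let $\mathring{\mathfrak g}$ be a finite-dimensional simple Lie algebra over $\mathbb C$ with Cartan subalgebra $\mathring{\mathfrak h}$ and a nondegenerate invariant symmetric bilinear form $(\cdot,\cdot)$. Fix $n\ge2$, $A=\mathbb C[t_1^{\pm1},\dots,t_n^{\pm1}]$, $t^{\underline m}=t_1^{m_1}\cdots t_n^{m_n}$. Let $\mathcal Z$ be spanned by symbols $t^{\underline m}K_i$ subject to $\sum_im_it^{\underline m}K_i=0$; $K_i=t^0K_i$; $d(t^{\underline r})t^{\underline s}=\sum_ir_it^{\underline r+\underline s}K_i$. The toroidal Lie algebra $\tau=\mathring{\mathfrak g}\otimes A\oplus\mathcal Z\oplus D$, $D=\mathrm{span}(d_1,\dots,d_n)$, has bracket $[X\otimes t^{\underline r},Y\otimes t^{\underline s}]=[X,Y]\otimes t^{\underline r+\underline s}+(X,Y)d(t^{\underline r})t^{\underline s}$, $\mathcal Z$ central in $\mathring{\mathfrak g}\otimes A\oplus\mathcal Z$, $[d_i,X\otimes t^{\underline r}]=r_iX\otimes t^{\underline r}$, $[d_i,t^{\underline m}K_j]=m_it^{\underline m}K_j$, $[d_i,d_j]=0$. A central operator of degree $\underline m\in\mathbb Z^n$ on a $\tau$-module $V$ is a linear map $z:V\to V$ commuting with the action of $\mathring{\mathfrak g}\otimes A\oplus\mathcal Z$ and satisfying $d_iz-zd_i=m_iz$ for all $i$. For $B\in GL(n,\mathbb Z)$, $\sigma_B$ is the automorphism of $\tau$ with $X\otimes t^{\underline r}\mapsto X\otimes t^{B\underline r}$,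 $d(t^{\underline r})t^{\underline s}\mapsto d(t^{B\underline r})t^{B\underline s}$, $d_i\mapsto\sum_k(B^{-1})_{ik}d_k$, and $V^{\sigma_B}$ is $V$ with action $x\cdot v=\sigma_B(x)v$. *)

theory Defs
  imports Complex_Main "HOL-Library.Function_Algebras"
begin

text \<open>Elements of Z^n are functions nat => int vanishing outside indices 0..n-1
  (index j here corresponds to index j+1 in the paper).\<close>

definition zvec :: "nat \<Rightarrow> (nat \<Rightarrow> int) \<Rightarrow> bool" where
  "zvec n r \<longleftrightarrow> (\<forall>j\<ge>n. r j = 0)"

definition zadd :: "(nat \<Rightarrow> int) \<Rightarrow> (nat \<Rightarrow> int) \<Rightarrow> (nat \<Rightarrow> int)" where
  "zadd r s = (\<lambda>j. r j + s j)"

definition zneg :: "(nat \<Rightarrow> int) \<Rightarrow> (nat \<Rightarrow> int)" where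
  "zneg r = (\<lambda>j. - r j)"

definition zzero :: "nat \<Rightarrow> int" where
  "zzero = (\<lambda>j. 0)"

definition matvec :: "nat \<Rightarrow> (nat \<Rightarrow> nat \<Rightarrow> int) \<Rightarrow> (nat \<Rightarrow> int) \<Rightarrow> (nat \<Rightarrow> int)" where
  "matvec n B r = (\<lambda>i. if i < n then (\<Sum>j<n. B i j * r j) else 0)"

definition inverse_int_mat :: "nat \<Rightarrow> (nat \<Rightarrow> nat \<Rightarrow> int) \<Rightarrow> (nat \<Rightarrow> nat \<Rightarrow> int) \<Rightarrow> bool" where
  "inverse_int_mat n B C \<longleftrightarrow>
     (\<forall>i<n. \<forall>j<n. (\<Sum>l<n. B i l * C l j) = (if i = j then 1 else 0)) \<and>
     (\<forall>i<n. \<forall>j<n. (\<Sum>l<n. C i l * B l j) = (if i = j then 1 else 0))"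

definition GL_int :: "nat \<Rightarrow> (nat \<Rightarrow> nat \<Rightarrow> int) \<Rightarrow> bool" where
  "GL_int n B \<longleftrightarrow> (\<exists>C. inverse_int_mat n B C)"

text \<open>Inverse of B (meaningful when GL_int n B).\<close>
definition mat_inv_int :: "nat \<Rightarrow> (nat \<Rightarrow> nat \<Rightarrow> int) \<Rightarrow> (nat \<Rightarrow> nat \<Rightarrow> int)" where
  "mat_inv_int n B = (SOME C. inverse_int_mat n B C)"

definition cscale :: "complex \<Rightarrow> (nat \<Rightarrow> complex) \<Rightarrow> (nat \<Rightarrow> complex)" where
  "cscale c f = (\<lambda>j. c * f j)"

definition cvec :: "(nat \<Rightarrow> int) \<Rightarrow> (nat \<Rightarrow> complex)" where
  "cvec r = (\<lambda>j. of_int (r j))"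

definition span_dim :: "(nat \<Rightarrow> int) set \<Rightarrow> nat" where
  "span_dim L = vector_space.dim cscale (cvec ` L)"

definition fin_dim :: "(complex \<Rightarrow> 'a::ab_group_add \<Rightarrow> 'a) \<Rightarrow> 'a set \<Rightarrow> bool" where
  "fin_dim sc S \<longleftrightarrow> (\<exists>F. finite F \<and> S \<subseteq> module.span sc F)"

definition lie_algebra :: "(complex \<Rightarrow> 'g \<Rightarrow> 'g) \<Rightarrow> ('g::ab_group_add \<Rightarrow> 'g \<Rightarrow> 'g) \<Rightarrow> bool" where
  "lie_algebra sg br \<longleftrightarrow> vector_space sg \<and>
     (\<forall>x y z. br (x + y) z = br x z + br y z) \<and>
     (\<forall>c x y. br (sg c x) y = sg c (br x y)) \<and>
     (\<forall>x y z. br x (y + z) = br x y + br x z) \<and>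
     (\<forall>c x y. br x (sg c y) = sg c (br x y)) \<and>
     (\<forall>x. br x x = 0) \<and>
     (\<forall>x y z. br x (br y z) + br y (br z x) + br z (br x y) = 0)"

definition lie_ideal :: "(complex \<Rightarrow> 'g \<Rightarrow> 'g) \<Rightarrow> ('g::ab_group_add \<Rightarrow> 'g \<Rightarrow> 'g) \<Rightarrow> 'g set \<Rightarrow> bool" where
  "lie_ideal sg br I \<longleftrightarrow> module.subspace sg I \<and> (\<forall>x y. y \<in> I \<longrightarrow> br x y \<in> I)"

definition simple_lie_algebra :: "(complex \<Rightarrow> 'g \<Rightarrow> 'g) \<Rightarrow> ('g::ab_group_add \<Rightarrow> 'g \<Rightarrow> 'g) \<Rightarrow> bool" where
  "simple_lie_algebra sg br \<longleftrightarrow> lie_algebra sg br \<and> fin_dim sg (UNIV::'g set) \<and>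
     (\<exists>x y. br x y \<noteq> 0) \<and>
     (\<forall>I. lie_ideal sg br I \<longrightarrow> I = {0} \<or> I = UNIV)"

text \<open>Cartan subalgebra: a nilpotent subalgebra that is its own normalizer.
  Nilpotency: all right-normed brackets of length N+1 of elements of h vanish.\<close>
fun iter_br :: "('g \<Rightarrow> 'g \<Rightarrow> 'g) \<Rightarrow> 'g list \<Rightarrow> 'g \<Rightarrow> 'g" where
  "iter_br br [] x = x"
| "iter_br br (y # ys) x = br y (iter_br br ys x)"

definition cartan_subalgebra :: "(complex \<Rightarrow> 'g \<Rightarrow> 'g) \<Rightarrow> ('g::ab_group_add \<Rightarrow> 'g \<Rightarrow> 'g) \<Rightarrow> 'g set \<Rightarrow> bool" where
  "cartan_subalgebra sg br h \<longleftrightarrow> module.subspace sg h \<and>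
     (\<forall>x\<in>h. \<forall>y\<in>h. br x y \<in> h) \<and>
     (\<exists>N. \<forall>ys x. set ys \<subseteq> h \<longrightarrow> length ys = N \<longrightarrow> x \<in> h \<longrightarrow> iter_br br ys x = 0) \<and>
     {x. \<forall>y\<in>h. br x y \<in> h} = h"

definition invariant_form :: "(complex \<Rightarrow> 'g \<Rightarrow> 'g) \<Rightarrow> ('g::ab_group_add \<Rightarrow> 'g \<Rightarrow> 'g) \<Rightarrow> ('g \<Rightarrow> 'g \<Rightarrow> complex) \<Rightarrow> bool" where
  "invariant_form sg br B \<longleftrightarrow>
     (\<forall>x y z. B (x + y) z = B x z + B y z) \<and>
     (\<forall>c x y. B (sg c x) y = c * B x y) \<and>
     (\<forall>x y. B x y = B y x) \<and>
     (\<forall>x y z. B (br x y) z = B x (br y z)) \<and>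
     (\<forall>x. (\<forall>y. B x y = 0) \<longrightarrow> x = 0)"

text \<open>A tau-module structure on V (scalar multiplication sv) is given by the actions of
  the spanning elements:  rg X r = action of X (x) t^r,  rK m i = action of t^m K_i,
  rd i = action of d_i  (indices i < n).  These determine a representation of tau
  exactly when the following relations hold.\<close>

definition lin_op :: "(complex \<Rightarrow> 'v::ab_group_add \<Rightarrow> 'v) \<Rightarrow> ('v \<Rightarrow> 'v) \<Rightarrow> bool" where
  "lin_op sv f \<longleftrightarrow> Vector_Spaces.linear sv sv f"

definition tau_module ::
  "nat \<Rightarrow> (complex \<Rightarrow> 'g \<Rightarrow> 'g) \<Rightarrow> ('g::ab_group_add \<Rightarrow> 'g \<Rightarrow> 'g) \<Rightarrow> ('g \<Rightarrow> 'g \<Rightarrow> complex) \<Rightarrow>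
   (complex \<Rightarrow> 'v::ab_group_add \<Rightarrow> 'v) \<Rightarrow> ('g \<Rightarrow> (nat \<Rightarrow> int) \<Rightarrow> 'v \<Rightarrow> 'v) \<Rightarrow>
   ((nat \<Rightarrow> int) \<Rightarrow> nat \<Rightarrow> 'v \<Rightarrow> 'v) \<Rightarrow> (nat \<Rightarrow> 'v \<Rightarrow> 'v) \<Rightarrow> bool" where
  "tau_module n sg br B sv rg rK rd \<longleftrightarrow> vector_space sv \<and>
     (\<forall>X r. zvec n r \<longrightarrow> lin_op sv (rg X r)) \<and>
     (\<forall>m i. zvec n m \<longrightarrow> i < n \<longrightarrow> lin_op sv (rK m i)) \<and>
     (\<forall>i<n. lin_op sv (rd i)) \<and>
     (\<forall>X Y r v. zvec n r \<longrightarrow> rg (X + Y) r v = rg X r v + rg Y r v) \<and>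
     (\<forall>c X r v. zvec n r \<longrightarrow> rg (sg c X) r v = sv c (rg X r v)) \<and>
     (\<forall>m v. zvec n m \<longrightarrow> (\<Sum>i<n. sv (of_int (m i)) (rK m i v)) = 0) \<and>
     (\<forall>X Y r s v. zvec n r \<longrightarrow> zvec n s \<longrightarrow>
        rg X r (rg Y s v) - rg Y s (rg X r v) =
        rg (br X Y) (zadd r s) v + sv (B X Y) (\<Sum>i<n. sv (of_int (r i)) (rK (zadd r s) i v))) \<and>
     (\<forall>X r m i v. zvec n r \<longrightarrow> zvec n m \<longrightarrow> i < n \<longrightarrow> rg X r (rK m i v) = rK m i (rg X r v)) \<and>
     (\<forall>m i m' j v. zvec n m \<longrightarrow> zvec n m' \<longrightarrow> i < n \<longrightarrow> j < n \<longrightarrow>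
        rK m i (rK m' j v) = rK m' j (rK m i v)) \<and>
     (\<forall>i X r v. i < n \<longrightarrow> zvec n r \<longrightarrow>
        rd i (rg X r v) - rg X r (rd i v) = sv (of_int (r i)) (rg X r v)) \<and>
     (\<forall>i m j v. i < n \<longrightarrow> zvec n m \<longrightarrow> j < n \<longrightarrow>
        rd i (rK m j v) - rK m j (rd i v) = sv (of_int (m i)) (rK m j v)) \<and>
     (\<forall>i j v. i < n \<longrightarrow> j < n \<longrightarrow> rd i (rd j v) = rd j (rd i v))"

definition tau_irreducible ::
  "nat \<Rightarrow> (complex \<Rightarrow> 'v::ab_group_add \<Rightarrow> 'v) \<Rightarrow> ('g \<Rightarrow> (nat \<Rightarrow> int) \<Rightarrow> 'v \<Rightarrow> 'v) \<Rightarrow>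
   ((nat \<Rightarrow> int) \<Rightarrow> nat \<Rightarrow> 'v \<Rightarrow> 'v) \<Rightarrow> (nat \<Rightarrow> 'v \<Rightarrow> 'v) \<Rightarrow> bool" where
  "tau_irreducible n sv rg rK rd \<longleftrightarrow> (UNIV::'v set) \<noteq> {0} \<and>
     (\<forall>W. module.subspace sv W \<longrightarrow>
        (\<forall>X r. zvec n r \<longrightarrow> rg X r ` W \<subseteq> W) \<longrightarrow>
        (\<forall>m i. zvec n m \<longrightarrow> i < n \<longrightarrow> rK m i ` W \<subseteq> W) \<longrightarrow>
        (\<forall>i<n. rd i ` W \<subseteq> W) \<longrightarrow> W = {0} \<or> W = UNIV)"

text \<open>Weights with respect to hh = h + Z_0 + span(d_j : j in J).  A weight is given by its
  values lam on h, c i on K_i (i < n) and a j on d_j (j in J).  The weight space of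
  V/W is represented by its preimage in V.\<close>
definition wt_space_mod ::
  "nat \<Rightarrow> (complex \<Rightarrow> 'v::ab_group_add \<Rightarrow> 'v) \<Rightarrow> 'v set \<Rightarrow> 'g set \<Rightarrow> nat set \<Rightarrow>
   ('g \<Rightarrow> (nat \<Rightarrow> int) \<Rightarrow> 'v \<Rightarrow> 'v) \<Rightarrow> ((nat \<Rightarrow> int) \<Rightarrow> nat \<Rightarrow> 'v \<Rightarrow> 'v) \<Rightarrow> (nat \<Rightarrow> 'v \<Rightarrow> 'v) \<Rightarrow>
   ('g \<Rightarrow> complex) \<Rightarrow> (nat \<Rightarrow> complex) \<Rightarrow> (nat \<Rightarrow> complex) \<Rightarrow> 'v set" where
  "wt_space_mod n sv W h J rg rK rd lam c a =
     {v. (\<forall>x\<in>h. rg x zzero v - sv (lam x) v \<in> W) \<and>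
         (\<forall>i<n. rK zzero i v - sv (c i) v \<in> W) \<and>
         (\<forall>j\<in>J. rd j v - sv (a j) v \<in> W)}"

definition fd_weight_quot ::
  "nat \<Rightarrow> (complex \<Rightarrow> 'v::ab_group_add \<Rightarrow> 'v) \<Rightarrow> 'v set \<Rightarrow> 'g set \<Rightarrow> nat set \<Rightarrow>
   ('g \<Rightarrow> (nat \<Rightarrow> int) \<Rightarrow> 'v \<Rightarrow> 'v) \<Rightarrow> ((nat \<Rightarrow> int) \<Rightarrow> nat \<Rightarrow> 'v \<Rightarrow> 'v) \<Rightarrow> (nat \<Rightarrow> 'v \<Rightarrow> 'v) \<Rightarrow> bool" where
  "fd_weight_quot n sv W h J rg rK rd \<longleftrightarrow>
     (UNIV::'v set) \<subseteq> module.span sv (W \<union> (\<Union>lam c a. wt_space_mod n sv W h J rg rK rd lam c a)) \<and>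
     (\<forall>lam c a. \<exists>F. finite F \<and> wt_space_mod n sv W h J rg rK rd lam c a \<subseteq> module.span sv (F \<union> W))"

definition tw_g :: "nat \<Rightarrow> (nat \<Rightarrow> nat \<Rightarrow> int) \<Rightarrow> ('g \<Rightarrow> (nat \<Rightarrow> int) \<Rightarrow> 'v::ab_group_add \<Rightarrow> 'v) \<Rightarrow> ('g \<Rightarrow> (nat \<Rightarrow> int) \<Rightarrow> 'v \<Rightarrow> 'v)" where
  "tw_g n B rg = (\<lambda>X r. rg X (matvec n B r))"

text \<open>sigma_B(t^m K_j) = sigma_B(d(t^(e_j)) t^(m - e_j)) = d(t^(B e_j)) t^(B m - B e_j)
  = sum_i B_ij t^(B m) K_i.\<close>
definition tw_K :: "nat \<Rightarrow> (nat \<Rightarrow> nat \<Rightarrow> int) \<Rightarrow> (complex \<Rightarrow> 'v::ab_group_add \<Rightarrow> 'v) \<Rightarrow>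
   ((nat \<Rightarrow> int) \<Rightarrow> nat \<Rightarrow> 'v \<Rightarrow> 'v) \<Rightarrow> ((nat \<Rightarrow> int) \<Rightarrow> nat \<Rightarrow> 'v \<Rightarrow> 'v)" where
  "tw_K n B sv rK = (\<lambda>m j v. \<Sum>i<n. sv (of_int (B i j)) (rK (matvec n B m) i v))"

definition tw_d :: "nat \<Rightarrow> (nat \<Rightarrow> nat \<Rightarrow> int) \<Rightarrow> (complex \<Rightarrow> 'v::ab_group_add \<Rightarrow> 'v) \<Rightarrow>
   (nat \<Rightarrow> 'v \<Rightarrow> 'v) \<Rightarrow> (nat \<Rightarrow> 'v \<Rightarrow> 'v)" where
  "tw_d n B sv rd = (\<lambda>i v. \<Sum>k<n. sv (of_int (mat_inv_int n B i k)) (rd k v))"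

definition central_op ::
  "nat \<Rightarrow> (complex \<Rightarrow> 'v::ab_group_add \<Rightarrow> 'v) \<Rightarrow> ('g \<Rightarrow> (nat \<Rightarrow> int) \<Rightarrow> 'v \<Rightarrow> 'v) \<Rightarrow>
   ((nat \<Rightarrow> int) \<Rightarrow> nat \<Rightarrow> 'v \<Rightarrow> 'v) \<Rightarrow> (nat \<Rightarrow> 'v \<Rightarrow> 'v) \<Rightarrow>
   (nat \<Rightarrow> int) \<Rightarrow> ('v \<Rightarrow> 'v) \<Rightarrow> bool" where
  "central_op n sv rg rK rd m z \<longleftrightarrow> lin_op sv z \<and>
     (\<forall>X r v. zvec n r \<longrightarrow> z (rg X r v) = rg X r (z v)) \<and>
     (\<forall>s j v. zvec n s \<longrightarrow> j < n \<longrightarrow> z (rK s j v) = rK s j (z v)) \<and>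
     (\<forall>i v. i < n \<longrightarrow> rd i (z v) - z (rd i v) = sv (of_int (m i)) (z v))"

end

theory Submission
  imports Defs "HOL-Computational_Algebra.Fundamental_Theorem_Algebra"
begin

text \<open>
  A nonzero central operator is bijective because its kernel and image are submodules, so the degrees
  of central operators form a group. Let \<open>z\<close> be a central operator of degree \<open>r\<close>, and suppose that the central
  operator \<open>T = \<Sum>\<^sub>i r\<^sub>i t\<^sup>m K\<^sub>i\<close> is nonzero. For \<open>X, Y\<close> in the Cartan subalgebra the operators
  \<open>X \<otimes> t\<^sup>r z\<^sup>-\<^sup>1\<close> and \<open>Y \<otimes> t\<^sup>m\<^sup>-\<^sup>r z T\<^sup>-\<^sup>1\<close> have degree zero, act on a finite-dimensional weight space and have
  the scalar \<open>(X, Y)\<close> as commutator. This is impossible when \<open>(X, Y) \<noteq> 0\<close>, so \<open>T = 0\<close>. Hence the central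
  charges are orthogonal to the span of \<open>L\<close>; this gives (4), and it forces \<open>k < n\<close>. The matrix \<open>B\<close> comes from a basis
  of \<open>\<int>\<^sup>n\<close> adapted to a lattice of central degrees spanning the same space as \<open>L\<close>, and \<open>W\<close> is the span of
  the images of the \<open>z\<^sub>i - 1\<close>, which glues together degrees that differ by multiples of \<open>deg z\<^sub>i\<close>.

  The form is nonzero on \<open>h\<close> because \<open>h\<close> acts diagonalizably on \<open>V\<close>: if the action is faithful, then
  \<open>h\<close> is abelian and \<open>ad x\<close> is semisimple at \<open>0\<close> for \<open>x \<in> h\<close>, so the part of \<open>g\<close> pairing with \<open>h\<close> can be
  pushed into the centralizer of \<open>h\<close>, which is \<open>h\<close>.
\<close>

section \<open>Operators on complex vector spaces\<close>

locale complex_vector_space = vector_space scale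
  for scale :: "complex \<Rightarrow> 'b::ab_group_add \<Rightarrow> 'b" (infixr "*s" 75)
begin

section \<open>Polynomials in a linear operator\<close>

definition poly_op :: "('b \<Rightarrow> 'b) \<Rightarrow> complex poly \<Rightarrow> 'b \<Rightarrow> 'b" where
  "poly_op Q p v = (\<Sum>i\<le>degree p. coeff p i *s (Q ^^ i) v)"

lemma linear_selfI:
  assumes "\<And>v w. f (v + w) = f v + f w" "\<And>c v. f (c *s v) = c *s f v"
  shows "Vector_Spaces.linear scale scale f"
  using assms vector_space_axioms by (simp add: Vector_Spaces.linear_iff)

lemma poly_op_atMost:
  fixes p :: "complex poly"
  shows "degree p \<le> N \<Longrightarrow> poly_op Q p v = (\<Sum>i\<le>N. coeff p i *s (Q ^^ i) v)"
  unfolding poly_op_def by (rule sum.mono_neutral_left) (auto simp: coeff_eq_0)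

lemma poly_op_add: "poly_op Q (p + q) v = poly_op Q p v + poly_op Q q v"
proof -
  let ?N = "max (degree p) (degree q)"
  have "degree (p + q) \<le> ?N" by (rule degree_add_le_max)
  then show ?thesis
    by (simp add: poly_op_atMost[of _ ?N] scale_left_distrib sum.distrib)
qed

lemma poly_op_smult: "poly_op Q (smult c p) v = c *s poly_op Q p v"
  by (simp add: poly_op_atMost[OF degree_smult_le] poly_op_def scale_sum_right)

lemma poly_op_0 [simp]: "poly_op Q 0 v = 0"
  by (simp add: poly_op_def)

lemma poly_op_pCons:
  assumes "Vector_Spaces.linear scale scale Q"
  shows "poly_op Q (pCons a p) v = a *s v + Q (poly_op Q p v)"
proof -
  interpret Q: Vector_Spaces.linear scale scale Q by fact
  have "poly_op Q (pCons a p) v = (\<Sum>i\<le>Suc (degree p). coeff (pCons a p) i *s (Q ^^ i) v)"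
    by (rule poly_op_atMost) (rule degree_pCons_le)
  also have "\<dots> = a *s v + (\<Sum>i\<le>degree p. coeff p i *s (Q ^^ Suc i) v)"
    by (subst sum.atMost_Suc_shift) simp
  also have "\<dots> = a *s v + Q (poly_op Q p v)"
    by (simp add: poly_op_def Q.sum Q.scale)
  finally show ?thesis .
qed

lemma funpow_invariant: "Q ` U \<subseteq> U \<Longrightarrow> u \<in> U \<Longrightarrow> (Q ^^ i) u \<in> U"
  by (induction i) auto

lemma poly_op_invariant:
  assumes "subspace U" "Q ` U \<subseteq> U" "u \<in> U"
  shows "poly_op Q p u \<in> U"
  unfolding poly_op_def using assms
  by (intro subspace_sum subspace_scale funpow_invariant) auto

text \<open>The \<open>card F + 1\<close> vectors \<open>u, Q u, ...\<close> lie in the span of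
  \<open>F\<close>, hence satisfy a linear relation; its coefficients form the polynomial.\<close>

lemma annihilating_poly_exists:
  assumes "finite F" "\<And>i. (Q ^^ i) u \<in> span F"
  shows "\<exists>p. p \<noteq> 0 \<and> poly_op Q p u = 0"
proof -
  let ?g = "\<lambda>i. (Q ^^ i) u" and ?N = "card F"
  \<comment> \<open>Dependence is a property of sets and does not see a repeated vector, so a
    repetition is treated first; it gives \<open>x^j - x^i\<close>.\<close>
  show ?thesis
  proof (cases "inj_on ?g {..?N}")
    case False
    then obtain i j where ij: "i < j" "?g i = ?g j"
      by (auto simp: inj_on_def) (metis nat_neq_iff)
    let ?p = "monom 1 j + smult (-1) (monom 1 i) :: complex poly"
    have mon: "poly_op Q (monom 1 l) u = ?g l" for l
      by (simp add: poly_op_def degree_monom_eq sum.delta if_distrib[of "\<lambda>c. c *s _"] cong: if_cong)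
    have "coeff ?p j = 1" using ij by simp
    then have "?p \<noteq> 0" by (metis coeff_0 zero_neq_one)
    moreover have "poly_op Q ?p u = 0"
      unfolding poly_op_add poly_op_smult mon using ij by simp
    ultimately show ?thesis by blast
  next
    case True
    let ?S = "?g ` {..?N}"
    have "card ?S = Suc ?N" by (simp add: card_image[OF True])
    then have "dependent ?S"
      using independent_span_bound[of F ?S] assms by (metis image_subsetI not_less_eq_eq order_refl)
    then obtain c v where c: "v \<in> ?S" "c v \<noteq> 0" "(\<Sum>v\<in>?S. c v *s v) = 0"
      unfolding dependent_finite[OF finite_imageI[OF finite_atMost]] by blast
    then obtain i0 where i0: "i0 \<le> ?N" "v = ?g i0" by blast
    define p where "p = Poly (map (\<lambda>i. c (?g i)) [0..<Suc ?N])"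
    have co: "coeff p i = (if i \<le> ?N then c (?g i) else 0)" for i
      unfolding p_def coeff_Poly_eq by (auto simp: nth_default_def simp del: upt_Suc)
    have "coeff p i0 \<noteq> 0" using co c i0 by simp
    then have "p \<noteq> 0" by auto
    have "degree p \<le> ?N" by (rule degree_le) (simp add: co)
    then have "poly_op Q p u = (\<Sum>i\<le>?N. c (?g i) *s ?g i)"
      by (simp add: poly_op_atMost co)
    also have "\<dots> = 0"
      using c(3) by (simp add: sum.reindex[OF True])
    finally show ?thesis using \<open>p \<noteq> 0\<close> by blast
  qed
qed

text \<open>Minimality is taken at the single vector \<open>u\<close>. It serves to show that a
  nonzero polynomial of smaller degree, such as a factor or a derivative of \<open>p\<close>, does
  not annihilate \<open>u\<close>.\<close>

lemma minimal_annihilating_poly: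
  assumes "finite F" "U \<subseteq> span F" "Q ` U \<subseteq> U" "u \<in> U"
  obtains p where "p \<noteq> 0" "poly_op Q p u = 0"
    "\<And>q. q \<noteq> 0 \<Longrightarrow> poly_op Q q u = 0 \<Longrightarrow> degree p \<le> degree q"
proof -
  have "\<exists>p. p \<noteq> 0 \<and> poly_op Q p u = 0"
    using assms(1) subsetD[OF assms(2) funpow_invariant[OF assms(3,4)]]
    by (rule annihilating_poly_exists)
  then obtain p where "p \<noteq> 0 \<and> poly_op Q p u = 0" ..
  then show ?thesis
    using that ex_has_least_nat[of "\<lambda>p. p \<noteq> 0 \<and> poly_op Q p u = 0" p degree] by metis
qed

section \<open>Decompositions into joint eigenspaces\<close>

text \<open>Induction on \<open>F\<close>. For \<open>s\<close> different from the new weight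
  \<open>t\<close>, apply \<open>T i - \<tau> i t\<close> with \<open>i\<close> separating the two:
  the summand at \<open>t\<close> disappears and the others are rescaled, the one at
  \<open>s\<close> by a nonzero factor.\<close>

lemma weight_vectors_independent:
  assumes lin: "\<And>i. i \<in> I \<Longrightarrow> Vector_Spaces.linear scale scale (T i)"
    and sub: "\<And>s. s \<in> S \<Longrightarrow> subspace (E s)"
    and eig: "\<And>i s v. i \<in> I \<Longrightarrow> s \<in> S \<Longrightarrow> v \<in> E s \<Longrightarrow> T i v = \<tau> i s *s v"
    and sep: "\<And>s t. s \<in> S \<Longrightarrow> t \<in> S \<Longrightarrow> s \<noteq> t \<Longrightarrow> \<exists>i\<in>I. \<tau> i s \<noteq> \<tau> i t"
    and "finite F" "F \<subseteq> S" "\<And>s. s \<in> F \<Longrightarrow> f s \<in> E s" "sum f F = 0" "s \<in> F"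
  shows "f s = 0"
  using assms(5-)
proof (induction F arbitrary: f s rule: finite_induct)
  case empty
  then show ?case by simp
next
  case (insert t F)
  have zero: "f s = 0" if s: "s \<in> F" for s
  proof -
    obtain i where i: "i \<in> I" "\<tau> i s \<noteq> \<tau> i t"
      using sep[of s t] s insert.hyps insert.prems by blast
    interpret T: Vector_Spaces.linear scale scale "T i" using lin i by blast
    have "0 = T i (\<Sum>s\<in>insert t F. f s) - \<tau> i t *s (\<Sum>s\<in>insert t F. f s)"
      using insert.prems by (simp add: T.zero)
    also have "\<dots> = (\<Sum>s\<in>insert t F. T i (f s) - \<tau> i t *s f s)"
      by (simp add: T.sum sum_subtractf scale_sum_right del: sum.insert)
    also have "\<dots> = (\<Sum>s\<in>insert t F. (\<tau> i s - \<tau> i t) *s f s)"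
      using insert.prems(1,2) eig[OF i(1)]
      by (intro sum.cong refl) (auto simp: scale_left_diff_distrib)
    also have "\<dots> = (\<Sum>s\<in>F. (\<tau> i s - \<tau> i t) *s f s)"
      using insert.hyps by simp
    finally have "(\<Sum>s\<in>F. (\<tau> i s - \<tau> i t) *s f s) = 0" by simp
    moreover have "(\<tau> i s - \<tau> i t) *s f s \<in> E s" if "s \<in> F" for s
      using that insert.prems sub by (intro subspace_scale) auto
    ultimately have "(\<tau> i s - \<tau> i t) *s f s = 0"
      using insert.IH[of "\<lambda>s. (\<tau> i s - \<tau> i t) *s f s" s] s insert.prems by auto
    then show ?thesis using i by simp
  qed
  then have "f t = 0" using insert.prems insert.hyps by simp
  then show ?case using zero insert.prems by blast
qed

text \<open>The family \<open>f\<close> is controlled on all of \<open>S\<close> and vanishes off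
  \<open>F\<close>, so that two decompositions can be padded to a common finite index set and
  compared.\<close>

lemma span_Union_decomposition:
  assumes sub: "\<And>s. s \<in> S \<Longrightarrow> subspace (E s)"
    and "v \<in> span (\<Union>s\<in>S. E s)"
  obtains F f where "finite F" "F \<subseteq> S" "\<And>s. s \<in> S \<Longrightarrow> f s \<in> E s" "\<And>s. s \<notin> F \<Longrightarrow> f s = 0" "v = sum f F"
proof -
  have "\<exists>F f. finite F \<and> F \<subseteq> S \<and> (\<forall>s\<in>S. f s \<in> E s) \<and> (\<forall>s. s \<notin> F \<longrightarrow> f s = 0) \<and> v = sum f F"
    using assms(2)
  proof (induction rule: span_induct_alt)
    case base
    have "\<forall>s\<in>S. 0 \<in> E s" using sub subspace_0 by blast
    then show ?case by (intro exI[of _ "{}"] exI[of _ "\<lambda>_. 0"]) simp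
  next
    case (step c x y)
    then obtain t where t: "t \<in> S" "x \<in> E t" by blast
    from step obtain F f where F: "finite F" "F \<subseteq> S" "\<forall>s\<in>S. f s \<in> E s" "\<forall>s. s \<notin> F \<longrightarrow> f s = 0" "y = sum f F"
      by blast
    have y: "y = sum f (insert t F)"
      unfolding F(5) using F by (intro sum.mono_neutral_left) auto
    have fs: "f(t := f t + c *s x) = (\<lambda>s. f s + (if s = t then c *s x else 0))" by auto
    have "c *s x + y = sum (f(t := f t + c *s x)) (insert t F)"
      unfolding fs using F(1) by (simp only: sum.distrib y sum.delta finite_insert) (simp add: add.commute)
    moreover have "\<forall>s\<in>S. (f(t := f t + c *s x)) s \<in> E s"
      using F t sub by (auto intro!: subspace_add subspace_scale)
    ultimately show ?case
      using F t by (intro exI[of _ "insert t F"] exI[of _ "f(t := f t + c *s x)"]) auto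
  qed
  then show ?thesis using that by blast
qed

text \<open>Operators prescribed on the components of a direct sum glue to a single one. The value
  is well defined because two decompositions of a vector, padded to the union of their index sets,
  agree term by term by \<open>indep\<close>.\<close>

lemma graded_linear_extension:
  assumes sub: "\<And>s. s \<in> S \<Longrightarrow> subspace (E s)"
    and span: "\<And>v. v \<in> span (\<Union>s\<in>S. E s)"
    and indep: "\<And>F f s. finite F \<Longrightarrow> F \<subseteq> S \<Longrightarrow> (\<And>s. s \<in> F \<Longrightarrow> f s \<in> E s) \<Longrightarrow> sum f F = 0 \<Longrightarrow> s \<in> F \<Longrightarrow> f s = 0"
    and lin: "\<And>s. s \<in> S \<Longrightarrow> Vector_Spaces.linear scale scale (N s)"
  obtains \<Phi> where "Vector_Spaces.linear scale scale \<Phi>" "\<And>s v. s \<in> S \<Longrightarrow> v \<in> E s \<Longrightarrow> \<Phi> v = N s v"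
proof -
  define R where "R v F f \<longleftrightarrow> finite F \<and> F \<subseteq> S \<and> (\<forall>s\<in>S. f s \<in> E s) \<and> (\<forall>s. s \<notin> F \<longrightarrow> f s = 0) \<and> v = sum f F"
    for v F f
  have ex: "\<exists>F f. R v F f" for v
    using span_Union_decomposition[OF sub span, of v] unfolding R_def by metis
  have N0: "N s 0 = 0" if "s \<in> S" for s
    using lin[OF that] by (simp add: linear_iff_module_hom module_hom.zero)
  have mono: "R v F' f" if "R v F f" "F \<subseteq> F'" "finite F'" "F' \<subseteq> S" for v F F' f
  proof -
    have "sum f F = sum f F'" using that unfolding R_def by (intro sum.mono_neutral_left) auto
    then show ?thesis using that unfolding R_def by auto
  qed
  have Nmono: "(\<Sum>s\<in>F. N s (f s)) = (\<Sum>s\<in>F'. N s (f s))"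
    if "R v F f" "F \<subseteq> F'" "finite F'" "F' \<subseteq> S" for v F F' f
    using that N0 unfolding R_def by (intro sum.mono_neutral_left) auto
  have uniq: "(\<Sum>s\<in>F. N s (f s)) = (\<Sum>s\<in>F'. N s (f' s))" if R: "R v F f" "R v F' f'" for v F f F' f'
  proof -
    let ?G = "F \<union> F'"
    have G: "finite ?G" "?G \<subseteq> S" using R unfolding R_def by auto
    have RG: "R v ?G f" "R v ?G f'" using mono R G by blast+
    have "f s - f' s = 0" if "s \<in> ?G" for s
      using RG that by (intro indep[of ?G "\<lambda>s. f s - f' s", OF G]) (auto simp: R_def sum_subtractf intro!: subspace_diff sub)
    then have "(\<Sum>s\<in>?G. N s (f s)) = (\<Sum>s\<in>?G. N s (f' s))" by (intro sum.cong) auto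
    then show ?thesis using Nmono[OF R(1) _ G] Nmono[OF R(2) _ G] by auto
  qed
  define \<Phi> where "\<Phi> v = (SOME w. \<exists>F f. R v F f \<and> w = (\<Sum>s\<in>F. N s (f s)))" for v
  have \<Phi>: "\<Phi> v = (\<Sum>s\<in>F. N s (f s))" if "R v F f" for v F f
  proof -
    have "\<exists>F f. R v F f \<and> \<Phi> v = (\<Sum>s\<in>F. N s (f s))"
      unfolding \<Phi>_def by (rule someI_ex) (use that in blast)
    then show ?thesis using uniq that by metis
  qed
  have "Vector_Spaces.linear scale scale \<Phi>"
  proof (rule linear_selfI)
    fix v w c
    obtain F f where f: "R v F f" using ex by blast
    obtain F' f' where f': "R w F' f'" using ex by blast
    let ?G = "F \<union> F'"
    have G: "finite ?G" "?G \<subseteq> S" using f f' unfolding R_def by auto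
    have RG: "R v ?G f" "R w ?G f'" using mono f f' G by blast+
    have "R (v + w) ?G (\<lambda>s. f s + f' s)"
      using RG sub by (auto simp: R_def sum.distrib subspace_add)
    then have "\<Phi> (v + w) = (\<Sum>s\<in>?G. N s (f s + f' s))" by (rule \<Phi>)
    also have "\<dots> = (\<Sum>s\<in>?G. N s (f s) + N s (f' s))"
      using G lin by (intro sum.cong refl) (metis linear_iff_module_hom module_hom.add subsetD)
    finally show "\<Phi> (v + w) = \<Phi> v + \<Phi> w"
      by (simp add: sum.distrib \<Phi>[OF RG(1)] \<Phi>[OF RG(2)])
    have "R (c *s v) F (\<lambda>s. c *s f s)"
      using f sub by (auto simp: R_def scale_sum_right subspace_scale)
    then have "\<Phi> (c *s v) = (\<Sum>s\<in>F. N s (c *s f s))" by (rule \<Phi>)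
    also have "\<dots> = (\<Sum>s\<in>F. c *s N s (f s))"
      using f lin unfolding R_def by (intro sum.cong refl) (metis linear_iff_module_hom module_hom.scale subsetD)
    finally show "\<Phi> (c *s v) = c *s \<Phi> v" by (simp add: \<Phi>[OF f] scale_sum_right)
  qed
  moreover have "\<Phi> v = N s v" if "s \<in> S" "v \<in> E s" for s v
  proof -
    have "R v {s} (\<lambda>t. if t = s then v else 0)"
      using that sub subspace_0 unfolding R_def by auto
    from \<Phi>[OF this] show ?thesis by simp
  qed
  ultimately show ?thesis using that by blast
qed

end

section \<open>Eigenvectors and scalar commutators\<close>

text \<open>Split a linear factor off a minimal annihilating polynomial,
  \<open>p = (x - l) q\<close>. By minimality \<open>poly_op Q q u\<close> is nonzero, and
  \<open>Q - l\<close> kills it.\<close>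

lemma (in complex_vector_space) eigenvector_exists:
  fixes Q :: "'b \<Rightarrow> 'b"
  assumes lin: "Vector_Spaces.linear scale scale Q"
    and "finite F" "subspace U" "U \<subseteq> span F" "Q ` U \<subseteq> U" "u \<in> U" "u \<noteq> 0"
  obtains l w where "w \<in> U" "w \<noteq> 0" "Q w = l *s w"
proof -
  obtain p where p: "p \<noteq> 0" "poly_op Q p u = 0"
    "\<And>q. q \<noteq> 0 \<Longrightarrow> poly_op Q q u = 0 \<Longrightarrow> degree p \<le> degree q"
    using minimal_annihilating_poly[OF assms(2,4,5,6)] by blast
  have "degree p > 0"
  proof (rule ccontr)
    assume "\<not> degree p > 0"
    then obtain a where "p = [:a:]" by (auto elim: degree_eq_zeroE)
    then have "p = pCons a 0" by simp
    then show False using p \<open>u \<noteq> 0\<close> by (simp add: poly_op_def)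
  qed
  then obtain l where "poly p l = 0"
    using fundamental_theorem_of_algebra[of p] by (auto simp: constant_degree)
  then obtain q where q: "p = [:-l, 1:] * q" by (auto simp: poly_eq_0_iff_dvd dvd_def)
  have "q \<noteq> 0" using p q by auto
  then have "degree q < degree p" unfolding q by (subst degree_mult_eq) auto
  then have "poly_op Q q u \<noteq> 0" using p(3)[of q] \<open>q \<noteq> 0\<close> by auto
  moreover have "Q (poly_op Q q u) = l *s poly_op Q q u"
  proof -
    have "p = smult (-l) q + pCons 0 q" unfolding q by simp
    then have "poly_op Q p u = (-l) *s poly_op Q q u + Q (poly_op Q q u)"
      by (simp only: poly_op_add poly_op_smult poly_op_pCons[OF lin]) simp
    then show ?thesis using p(2) by simp
  qed
  moreover have "poly_op Q q u \<in> U" using assms by (intro poly_op_invariant)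
  ultimately show ?thesis using that by blast
qed

text \<open>Take an eigenvector \<open>w\<close> of \<open>Q\<close> and a minimal \<open>p\<close>
  with \<open>p(P) w = 0\<close>. If \<open>c\<close> were nonzero, the derivative of
  \<open>p\<close> would be a nonzero polynomial of smaller degree that also annihilates
  \<open>w\<close>.\<close>

lemma (in complex_vector_space) scalar_commutator_zero:
  fixes P Q :: "'b \<Rightarrow> 'b"
  assumes linP: "Vector_Spaces.linear scale scale P" and linQ: "Vector_Spaces.linear scale scale Q"
    and U: "finite F" "subspace U" "U \<subseteq> span F" "P ` U \<subseteq> U" "Q ` U \<subseteq> U" "u \<in> U" "u \<noteq> 0"
    and comm: "\<And>v. v \<in> U \<Longrightarrow> P (Q v) - Q (P v) = c *s v"
  shows "c = 0"
proof (rule ccontr)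
  assume "c \<noteq> 0"
  obtain l w where w: "w \<in> U" "w \<noteq> 0" "Q w = l *s w"
    using eigenvector_exists[OF linQ U(1,2,3,5,6,7)] by metis
  interpret P: Vector_Spaces.linear scale scale P by fact
  interpret Q: Vector_Spaces.linear scale scale Q by fact
  \<comment> \<open>On \<open>w\<close>, the operator \<open>Q - l\<close> acts on polynomials in \<open>P\<close> as \<open>-c\<close> times differentiation.\<close>
  have deriv: "Q (poly_op P p w) - l *s poly_op P p w = - (c *s poly_op P (pderiv p) w)" for p
  proof (induction p)
    case 0
    then show ?case by (simp add: Q.zero)
  next
    case (pCons a p)
    let ?v = "poly_op P p w"
    have "?v \<in> U" using U w by (intro poly_op_invariant) auto
    then have "Q (P ?v) = P (Q ?v) - c *s ?v" using comm[of ?v] by (simp add: algebra_simps)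
    moreover have "Q ?v = l *s ?v - c *s poly_op P (pderiv p) w"
      using pCons.IH by (simp add: algebra_simps)
    ultimately have "Q (P ?v) = l *s P ?v - c *s P (poly_op P (pderiv p) w) - c *s ?v"
      by (simp add: P.diff P.scale)
    moreover have "Q (a *s w) = l *s a *s w"
      by (simp add: Q.scale w mult.commute)
    ultimately show ?case
      by (simp add: poly_op_pCons[OF linP] pderiv_pCons poly_op_add Q.add scale_right_distrib)
  qed
  obtain p where p: "p \<noteq> 0" "poly_op P p w = 0"
    "\<And>q. q \<noteq> 0 \<Longrightarrow> poly_op P q w = 0 \<Longrightarrow> degree p \<le> degree q"
    using minimal_annihilating_poly[OF U(1,3,4) w(1)] by blast
  have "poly_op P (pderiv p) w = 0"
    using deriv[of p] p \<open>c \<noteq> 0\<close> by (simp add: Q.zero)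
  moreover have "degree p > 0"
  proof (rule ccontr)
    assume "\<not> degree p > 0"
    then obtain a where "p = [:a:]" by (auto elim: degree_eq_zeroE)
    then show False using p w by (simp add: poly_op_def)
  qed
  moreover from this have "pderiv p \<noteq> 0" by (simp add: pderiv_eq_0_iff)
  ultimately have "degree p \<le> degree (pderiv p)" using p(3) by blast
  moreover have "degree (pderiv p) \<le> degree p - 1"
    by (rule degree_le) (auto simp: coeff_pderiv coeff_eq_0)
  ultimately show False using \<open>degree p > 0\<close> by simp
qed

text \<open>For a diagonalizable \<open>T\<close> the kernels of \<open>(T - \<kappa>)^2\<close> and
  \<open>T - \<kappa>\<close> coincide: on the \<open>\<mu>\<close>-component of \<open>w\<close>
  the square acts by \<open>(\<mu> - \<kappa>)^2\<close>, and if this kills the component, so does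
  \<open>\<mu> - \<kappa>\<close>.\<close>

lemma (in complex_vector_space) eigenvector_in_image_zero:
  assumes lin: "Vector_Spaces.linear scale scale T"
    and diag: "\<And>v. v \<in> span (\<Union>\<mu>\<in>UNIV. {v. T v = \<mu> *s v})"
    and u: "u = T w - \<kappa> *s w" "T u = \<kappa> *s u"
  shows "u = 0"
proof -
  interpret T: Vector_Spaces.linear scale scale T by fact
  let ?E = "\<lambda>\<mu>. {v. T v = \<mu> *s v}"
  have sub: "subspace (?E \<mu>)" for \<mu>
    by (auto simp: subspace_def T.zero T.add T.scale scale_right_distrib scale_left_commute)
  obtain F f where F: "finite F" "\<And>\<mu>. f \<mu> \<in> ?E \<mu>" "w = sum f F"
    by (rule span_Union_decomposition[of UNIV ?E w]) (use sub diag in auto)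
  have f: "T (f \<mu>) = \<mu> *s f \<mu>" for \<mu> using F(2) by simp
  have ue: "u = (\<Sum>\<mu>\<in>F. (\<mu> - \<kappa>) *s f \<mu>)"
    unfolding u F(3) by (simp add: T.sum f scale_sum_right sum_subtractf[symmetric] scale_left_diff_distrib)
  have "0 = T u - \<kappa> *s u" using u by simp
  also have "\<dots> = (\<Sum>\<mu>\<in>F. (\<mu> - \<kappa>) *s (\<mu> - \<kappa>) *s f \<mu>)"
    unfolding ue T.sum scale_sum_right sum_subtractf[symmetric]
  proof (intro sum.cong refl)
    fix \<mu>
    have "T ((\<mu> - \<kappa>) *s f \<mu>) - \<kappa> *s (\<mu> - \<kappa>) *s f \<mu> = ((\<mu> - \<kappa>) * \<mu> - \<kappa> * (\<mu> - \<kappa>)) *s f \<mu>"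
      unfolding scale_left_diff_distrib[of "_ * _"] by (simp add: T.scale f)
    also have "(\<mu> - \<kappa>) * \<mu> - \<kappa> * (\<mu> - \<kappa>) = (\<mu> - \<kappa>) * (\<mu> - \<kappa>)" by (simp add: algebra_simps)
    finally show "T ((\<mu> - \<kappa>) *s f \<mu>) - \<kappa> *s (\<mu> - \<kappa>) *s f \<mu> = (\<mu> - \<kappa>) *s (\<mu> - \<kappa>) *s f \<mu>" by simp
  qed
  finally have zero: "(\<Sum>\<mu>\<in>F. (\<mu> - \<kappa>) *s (\<mu> - \<kappa>) *s f \<mu>) = 0" by simp
  \<comment> \<open>A single operator separates its own eigenvalues, hence the one-element index
    set.\<close>
  have "(\<mu> - \<kappa>) *s (\<mu> - \<kappa>) *s f \<mu> = 0" if "\<mu> \<in> F" for \<mu>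
  proof (rule weight_vectors_independent[where I = "{()}" and T = "\<lambda>_. T" and S = UNIV and E = ?E
        and \<tau> = "\<lambda>_ \<mu>. \<mu>" and F = F and f = "\<lambda>\<mu>. (\<mu> - \<kappa>) *s (\<mu> - \<kappa>) *s f \<mu>"])
    show "(\<mu> - \<kappa>) *s (\<mu> - \<kappa>) *s f \<mu> \<in> ?E \<mu>" for \<mu>
      using F(2) by (intro subspace_scale sub)
  qed (use F sub zero lin that in auto)
  then show ?thesis unfolding ue by (intro sum.neutral) auto
qed

section \<open>Adapted bases of integer lattices\<close>

text \<open>Entries of \<open>B\<close> outside the \<open>n\<close> by \<open>n\<close> block are
  arbitrary, so the column is cut off to be an element of Z^n in the sense of
  \<open>zvec\<close>.\<close>

definition int_col :: "nat \<Rightarrow> (nat \<Rightarrow> nat \<Rightarrow> int) \<Rightarrow> nat \<Rightarrow> nat \<Rightarrow> int" where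
  "int_col n B i = (\<lambda>a. if a < n then B a i else 0)"

definition add_col :: "(nat \<Rightarrow> nat \<Rightarrow> int) \<Rightarrow> nat \<Rightarrow> nat \<Rightarrow> int \<Rightarrow> nat \<Rightarrow> nat \<Rightarrow> int" where
  "add_col B j p q = (\<lambda>a b. B a b + (if b = j then q * B a p else 0))"

text \<open>The inverse of the new matrix arises from the old inverse by subtracting
  \<open>q\<close> times row \<open>j\<close> from row \<open>p\<close>.\<close>

lemma GL_int_add_col:
  assumes "GL_int n B" "p < n" "j < n" "p \<noteq> j"
  shows "GL_int n (add_col B j p q)"
proof -
  obtain C where C: "inverse_int_mat n B C" using assms(1) unfolding GL_int_def by blast
  let ?C = "\<lambda>a b. C a b - (if a = p then q * C j b else 0)"
  have "(\<Sum>b<n. add_col B j p q a b * ?C b c) = (\<Sum>b<n. B a b * C b c)" for a c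
  proof -
    have "add_col B j p q a b * ?C b c =
        B a b * C b c + (if b = j then q * B a p * C j c else 0) - (if b = p then q * B a p * C j c else 0)" for b
      using assms(4) by (auto simp: add_col_def algebra_simps)
    then show ?thesis using assms by (simp add: sum.distrib sum_subtractf)
  qed
  moreover have "(\<Sum>b<n. ?C a b * add_col B j p q b c) =
      (if a = c then 1 else 0)" if "a < n" "c < n" for a c
  proof -
    have inv: "(\<Sum>b<n. C a b * B b c) = (if a = c then 1 else 0)" if "a < n" "c < n" for a c
      using C that unfolding inverse_int_mat_def by blast
    have "(\<Sum>b<n. ?C a b * add_col B j p q b c) =
       (\<Sum>b<n. C a b * B b c + (if c = j then q else 0) * (C a b * B b p)
         - (if a = p then q else 0) * (C j b * B b c)
         - (if a = p then q else 0) * (if c = j then q else 0) * (C j b * B b p))"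
      by (intro sum.cong) (auto simp: add_col_def algebra_simps)
    also have "\<dots> = (if a = c then 1 else 0) + (if c = j then q else 0) * (if a = p then 1 else 0)
         - (if a = p then q else 0) * (if j = c then 1 else 0)
         - (if a = p then q else 0) * (if c = j then q else 0) * (if j = p then 1 else 0)"
      unfolding sum.distrib sum_subtractf sum_distrib_left[symmetric]
      using that assms by (simp add: inv)
    finally show ?thesis using assms(4) by auto
  qed
  ultimately show ?thesis
    using C unfolding GL_int_def inverse_int_mat_def by (intro exI[of _ ?C]) simp
qed

lemma matvec_add_col:
  assumes "p < n" "j < n" "p \<noteq> j"
  shows "matvec n (add_col B j p q) (s(p := s p - q * s j)) = matvec n B s"
proof -
  have "add_col B j p q a b * (s(p := s p - q * s j)) b =
     B a b * s b + (if b = j then q * B a p * s j else 0) - (if b = p then q * B a p * s j else 0)" for a b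
    using assms(3) by (auto simp: add_col_def algebra_simps)
  then show ?thesis using assms by (auto simp: matvec_def sum.distrib sum_subtractf)
qed

text \<open>The Euclidean algorithm on the coordinates \<open>s\<close>, with the sum of their
  absolute values as measure. Only columns at nonzero coordinates are changed; these have index at
  least \<open>l\<close>, so the first \<open>l\<close> columns survive.\<close>

lemma concentrate_coordinates:
  assumes "GL_int n B" "\<forall>j<l. s j = 0" "\<exists>j<n. s j \<noteq> 0"
  shows "\<exists>B' p d. GL_int n B' \<and> (\<forall>j<l. \<forall>a. B' a j = B a j) \<and> l \<le> p \<and> p < n \<and> d \<noteq> 0 \<and>
           matvec n B s = (\<lambda>a. d * int_col n B' p a)"
  using assms
proof (induction "\<Sum>j<n. nat \<bar>s j\<bar>" arbitrary: B s rule: less_induct)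
  case less
  from less.prems(3) obtain j where j: "j < n" "s j \<noteq> 0" by blast
  have jl: "l \<le> j" using j less.prems(2) by (metis not_le)
  show ?case
  proof (cases "\<exists>p<n. p \<noteq> j \<and> s p \<noteq> 0")
    case False
    then have "matvec n B s = (\<lambda>a. s j * int_col n B j a)"
      using j by (auto simp: matvec_def int_col_def fun_eq_iff sum.remove[of "{..<n}" j] intro!: sum.neutral)
    then show ?thesis using less.prems j jl by blast
  next
    case True
    \<comment> \<open>Stated for an arbitrary pair because the larger of the two coordinates, which
      is to be reduced, may be either one.\<close>
    have step: ?thesis if pj: "p < n" "j < n" "p \<noteq> j" "s p \<noteq> 0" "s j \<noteq> 0" "\<bar>s j\<bar> \<le> \<bar>s p\<bar>" for p j
    proof -
      have l: "l \<le> p" "l \<le> j" using pj less.prems(2) by (metis not_le)+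
      \<comment> \<open>The sign makes \<open>\<bar>s p - q * s j\<bar>\<close> equal to
        \<open>\<bar>s p\<bar> - \<bar>s j\<bar>\<close>.\<close>
      define q where "q = (if sgn (s p) = sgn (s j) then 1 else -1 :: int)"
      let ?s = "s(p := s p - q * s j)" and ?B = "add_col B j p q"
      have "\<bar>s p - q * s j\<bar> < \<bar>s p\<bar>"
        using pj by (auto simp: q_def sgn_if split: if_splits)
      then have "(\<Sum>b<n. nat \<bar>?s b\<bar>) < (\<Sum>b<n. nat \<bar>s b\<bar>)"
        using pj by (intro sum_strict_mono_ex1) (auto intro!: bexI[of _ p])
      moreover have "GL_int n ?B" using less.prems pj by (intro GL_int_add_col)
      moreover have "\<forall>j<l. ?s j = 0" using less.prems l by auto
      moreover have "\<exists>j<n. ?s j \<noteq> 0" using pj by (intro exI[of _ j]) auto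
      ultimately obtain B' r d where B': "GL_int n B'" "\<forall>j<l. \<forall>a. B' a j = ?B a j" "l \<le> r" "r < n" "d \<noteq> 0"
          "matvec n ?B ?s = (\<lambda>a. d * int_col n B' r a)"
        using less.hyps[of ?s ?B] by blast
      have "\<forall>i<l. \<forall>a. B' a i = B a i" using B'(2) l by (auto simp: add_col_def)
      then show ?thesis using B' matvec_add_col[OF pj(1-3), of B q s] by metis
    qed
    from True obtain p where "p < n" "p \<noteq> j" "s p \<noteq> 0" by blast
    then show ?thesis using step[of p j] step[of j p] j linear[of "\<bar>s j\<bar>" "\<bar>s p\<bar>"] by blast
  qed
qed

lemma concentrate_first_coordinate:
  assumes "GL_int n B" "\<forall>j<l. s j = 0" "\<exists>j<n. s j \<noteq> 0" "l < n"
  shows "\<exists>B' d. GL_int n B' \<and> (\<forall>j<l. \<forall>a. B' a j = B a j) \<and> d \<noteq> 0 \<and>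
           matvec n B s = (\<lambda>a. d * int_col n B' l a)"
proof -
  obtain B' p d where B': "GL_int n B'" "\<forall>j<l. \<forall>a. B' a j = B a j" "l \<le> p" "p < n" "d \<noteq> 0"
      "matvec n B s = (\<lambda>a. d * int_col n B' p a)"
    using concentrate_coordinates[OF assms(1-3)] by blast
  show ?thesis
  proof (cases "p = l")
    case False
    \<comment> \<open>Column \<open>p\<close> becomes column \<open>p\<close> minus column
      \<open>l\<close>; adding this to column \<open>l\<close> leaves the old column
      \<open>p\<close> in place \<open>l\<close>. Columns before \<open>l\<close> are untouched
      since \<open>p\<close> exceeds \<open>l\<close>.\<close>
    let ?B = "add_col (add_col B' p l (-1)) l p 1"
    have "GL_int n ?B" using B' False assms by (intro GL_int_add_col) auto
    moreover have "int_col n ?B l = int_col n B' p"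
      using False by (auto simp: int_col_def add_col_def)
    moreover have "\<forall>j<l. \<forall>a. ?B a j = B a j" using B' by (auto simp: add_col_def)
    ultimately show ?thesis using B' by metis
  qed (use B' in blast)
qed

lemma GL_int_id: "GL_int n (\<lambda>i j. if i = j then 1 else 0)"
proof -
  have "(\<Sum>l<n. (if i = l then 1 else 0) * (if l = j then 1 else 0)) = (if i = j then 1 else 0 :: int)"
    if "i < n" for i j
    using that by (subst sum.remove[of _ i]) (auto intro!: sum.neutral)
  then show ?thesis
    unfolding GL_int_def inverse_int_mat_def by (intro exI[of _ "\<lambda>i j. if i = j then 1 else 0"]) simp
qed

lemma matvec_inverse:
  assumes "inverse_int_mat n B C" "zvec n r"
  shows "matvec n B (matvec n C r) = r"
proof
  fix i
  show "matvec n B (matvec n C r) i = r i"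
  proof (cases "i < n")
    case True
    have "matvec n B (matvec n C r) i = (\<Sum>j<n. \<Sum>l<n. B i j * C j l * r l)"
      using True by (simp add: matvec_def sum_distrib_left mult.assoc)
    also have "\<dots> = (\<Sum>l<n. (\<Sum>j<n. B i j * C j l) * r l)"
      by (subst sum.swap) (simp add: sum_distrib_right)
    also have "\<dots> = (\<Sum>l<n. (if l = i then r l else 0))"
      using assms True by (intro sum.cong) (auto simp: inverse_int_mat_def)
    finally show ?thesis using True by simp
  qed (use assms in \<open>auto simp: matvec_def zvec_def\<close>)
qed

lemma inverse_int_mat_sym: "inverse_int_mat n B C \<Longrightarrow> inverse_int_mat n C B"
  unfolding inverse_int_mat_def by blast

lemma inverse_mat_inv_int: "GL_int n B \<Longrightarrow> inverse_int_mat n B (mat_inv_int n B)"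
  unfolding GL_int_def mat_inv_int_def by (rule someI_ex[of "inverse_int_mat n B"])

lemma zvec_matvec [simp]: "zvec n (matvec n B r)"
  by (simp add: zvec_def matvec_def)

section \<open>Bases adapted to a subgroup of Z^n\<close>

text \<open>A weak form of the elementary divisor theorem: the first \<open>l\<close> columns have
  the same rational span as \<open>H\<close>, and positive multiples of them lie in
  \<open>H\<close>, but these multiples are not claimed to generate \<open>H\<close>.\<close>

lemma adapted_lattice_basis:
  assumes zero: "zzero \<in> H" and diff: "\<And>r s. r \<in> H \<Longrightarrow> s \<in> H \<Longrightarrow> (\<lambda>j. r j - s j) \<in> H"
    and zvec: "\<And>r. r \<in> H \<Longrightarrow> zvec n r"
  shows "\<exists>B l m. GL_int n B \<and> l \<le> n \<and> (\<forall>i<l. 0 < m i \<and> (\<lambda>a. m i * int_col n B i a) \<in> H) \<and>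
           (\<forall>r\<in>H. \<exists>s. (\<forall>j\<ge>l. s j = 0) \<and> r = matvec n B s)"
proof (rule ccontr)
  assume contra: "\<not> ?thesis"
  have neg: "(\<lambda>j. - r j) \<in> H" if "r \<in> H" for r
    using diff[OF zero that] by (simp add: zzero_def)
  have add: "(\<lambda>j. r j + s j) \<in> H" if "r \<in> H" "s \<in> H" for r s
    using diff[OF that(1) neg[OF that(2)]] by simp
  have mult: "(\<lambda>j. q * r j) \<in> H" if "r \<in> H" for q r
  proof (induction q rule: int_induct[where k = 0])
    case base
    then show ?case using zero by (simp add: zzero_def)
  next
    case (step1 i)
    show ?case using add[OF step1(2) that] by (simp add: distrib_right)
  next
    case (step2 i)
    show ?case using diff[OF step2(2) that] by (simp add: left_diff_distrib)
  qed
  have sum: "(\<lambda>j. \<Sum>i<l. f i j) \<in> H" if "\<And>i. i < l \<Longrightarrow> f i \<in> H" for f and l :: nat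
    using that
  proof (induction l)
    case 0
    then show ?case using zero by (simp add: zzero_def)
  next
    case (Suc l)
    then show ?case using add[of "\<lambda>j. \<Sum>i<l. f i j" "f l"] by simp
  qed
  \<comment> \<open>If no partial basis captures all of \<open>H\<close>, each one can be extended
    by a further column; length \<open>Suc n\<close> then contradicts
    \<open>l \<le> n\<close>.\<close>
  have "\<exists>B m. GL_int n B \<and> l \<le> n \<and> (\<forall>i<l. 0 < m i \<and> (\<lambda>a. m i * int_col n B i a) \<in> H)" for l
  proof (induction l)
    case 0
    then show ?case using GL_int_id by blast
  next
    case (Suc l)
    then obtain B m where Bm: "GL_int n B" "l \<le> n" "\<forall>i<l. 0 < m i \<and> (\<lambda>a. m i * int_col n B i a) \<in> H" by blast
    then obtain r where r: "r \<in> H" and nex: "\<And>s. (\<forall>j\<ge>l. s j = 0) \<Longrightarrow> r \<noteq> matvec n B s"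
      using contra by blast
    obtain C where C: "inverse_int_mat n B C" using Bm unfolding GL_int_def by blast
    define s where "s = matvec n C r"
    have rs: "r = matvec n B s" unfolding s_def using matvec_inverse[OF C zvec[OF r]] by simp
    have "zvec n s" by (simp add: s_def)
    obtain j where j: "l \<le> j" "s j \<noteq> 0" using nex[of s] rs by blast
    have jn: "j < n" using j \<open>zvec n s\<close> by (metis not_le zvec_def)
    \<comment> \<open>\<open>M\<close> is a common multiple of the \<open>m i\<close>. Hence the
      part of \<open>M * r\<close> along the first \<open>l\<close> columns is an integral
      combination of the elements \<open>m i * int_col n B i\<close> of \<open>H\<close>;
      subtracting it gives \<open>r'\<close> in \<open>H\<close> with coordinates
      \<open>s'\<close>.\<close>
    define M where "M = (\<Prod>i<l. m i)"
    have "M > 0" unfolding M_def using Bm by (intro prod_pos) auto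
    have Mdiv: "M div m i * m i = M" if "i < l" for i
      using that unfolding M_def by (intro dvd_div_mult_self dvd_prodI) auto
    define r' where "r' = (\<lambda>a. M * r a - (\<Sum>i<l. s i * (M div m i) * (m i * int_col n B i a)))"
    have "r' \<in> H"
      unfolding r'_def using Bm by (intro diff sum mult[of _ "_ * _"] mult[OF r]) auto
    define s' where "s' = (\<lambda>j. if j < l then 0 else M * s j)"
    have "matvec n B s' = r'"
    proof
      fix a
      show "matvec n B s' a = r' a"
      proof (cases "a < n")
        case True
        have "(\<Sum>j<n. B a j * s' j) = (\<Sum>j<n. M * (B a j * s j)) - (\<Sum>j<n. if j < l then M * B a j * s j else 0)"
          unfolding sum_subtractf[symmetric] s'_def by (intro sum.cong) auto
        also have "(\<Sum>j<n. if j < l then M * B a j * s j else 0) = (\<Sum>j<l. M * B a j * s j)"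
          using Bm(2) by (intro sum.mono_neutral_cong_right) auto
        also have "\<dots> = (\<Sum>j<l. s j * (M div m j) * (m j * B a j))"
        proof (intro sum.cong refl)
          fix j assume "j \<in> {..<l}"
          then have "M * B a j * s j = (M div m j * m j) * B a j * s j" by (simp add: Mdiv)
          then show "M * B a j * s j = s j * (M div m j) * (m j * B a j)" by (simp only: mult_ac)
        qed
        finally show ?thesis
          using True by (simp add: matvec_def r'_def rs int_col_def sum_distrib_left)
      next
        case False
        then show ?thesis using zvec[OF \<open>r' \<in> H\<close>] by (simp add: matvec_def zvec_def)
      qed
    qed
    moreover have "\<forall>j<l. s' j = 0" "\<exists>j<n. s' j \<noteq> 0" "l < n"
      using j jn \<open>M > 0\<close> by (auto simp: s'_def intro!: exI[of _ j])
    ultimately obtain B' d where B': "GL_int n B'" "\<forall>j<l. \<forall>a. B' a j = B a j" "d \<noteq> 0"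
        "r' = (\<lambda>a. d * int_col n B' l a)"
      using concentrate_first_coordinate[OF Bm(1), of l s'] by metis
    \<comment> \<open>Multiplication by \<open>sgn d\<close> makes the new multiplier
      positive.\<close>
    have "(\<lambda>a. \<bar>d\<bar> * int_col n B' l a) \<in> H"
      using mult[OF \<open>r' \<in> H\<close>, of "sgn d"] unfolding B'(4) by (simp add: mult.assoc[symmetric] abs_sgn mult.commute)
    moreover have "(\<lambda>a. m i * int_col n B' i a) \<in> H" if "i < l" for i
    proof -
      have "int_col n B' i = int_col n B i" using B'(2) that by (auto simp: int_col_def)
      then show ?thesis using Bm(3) that by simp
    qed
    ultimately have "\<forall>i<Suc l. 0 < (m(l := \<bar>d\<bar>)) i \<and> (\<lambda>a. (m(l := \<bar>d\<bar>)) i * int_col n B' i a) \<in> H"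
      using Bm(3) B'(3) by (auto simp: less_Suc_eq)
    then show ?case using B'(1) \<open>l < n\<close> Suc_leI by blast
  qed
  from this[of "Suc n"] show False by auto
qed

text \<open>The inverse matrix takes column \<open>i\<close> of \<open>B\<close> to the
  \<open>i\<close>-th unit vector. After the twist, an operator whose degree is a multiple of that
  column has its degree in place \<open>i\<close> alone.\<close>

lemma mat_inv_int_col:
  assumes "GL_int n B" "i < n" "j < n"
  shows "(\<Sum>l<n. mat_inv_int n B j l * (m * int_col n B i l)) = (if j = i then m else 0)"
proof -
  have "(\<Sum>l<n. mat_inv_int n B j l * (m * int_col n B i l)) = m * (\<Sum>l<n. mat_inv_int n B j l * B l i)"
    unfolding sum_distrib_left by (intro sum.cong) (auto simp: int_col_def)
  then show ?thesis
    using inverse_mat_inv_int[OF assms(1)] assms(2,3) unfolding inverse_int_mat_def by simp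
qed

interpretation cfun: vector_space cscale
  by unfold_locales (auto simp: cscale_def fun_eq_iff algebra_simps)

lemma cscale_sum_apply: "(\<Sum>i\<in>I. cscale (c i) (f i)) a = (\<Sum>i\<in>I. c i * f i a)"
  by (induction I rule: infinite_finite_induct) (auto simp: cscale_def)

text \<open>The first \<open>l\<close> columns become a basis of the complex span of
  \<open>L\<close>.\<close>

lemma span_dim_adapted_basis:
  assumes B: "GL_int n B" and l: "l \<le> n"
    and col: "\<And>i. i < l \<Longrightarrow> cvec (int_col n B i) \<in> cfun.span (cvec ` L)"
    and coord: "\<And>r. r \<in> L \<Longrightarrow> \<exists>s. (\<forall>j\<ge>l. s j = 0) \<and> r = matvec n B s"
  shows "span_dim L = l"
proof -
  obtain C where C: "inverse_int_mat n B C" using B unfolding GL_int_def by blast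
  let ?b = "\<lambda>i. cvec (int_col n B i)"
  \<comment> \<open>The rows of the inverse matrix are the functionals dual to the columns of
    \<open>B\<close>; they yield both distinctness and independence.\<close>
  define \<phi> where "\<phi> i v = (\<Sum>a<n. of_int (C i a) * v a)" for i and v :: "nat \<Rightarrow> complex"
  have \<phi>b: "\<phi> i (?b j) = (if i = j then 1 else 0)" if "i < n" "j < n" for i j
  proof -
    have "\<phi> i (?b j) = of_int (\<Sum>a<n. C i a * B a j)"
      by (simp add: \<phi>_def cvec_def int_col_def)
    then show ?thesis using C that unfolding inverse_int_mat_def by auto
  qed
  have inj: "inj_on ?b {..<l}"
  proof (rule inj_onI)
    fix i j assume "i \<in> {..<l}" "j \<in> {..<l}" "?b i = ?b j"
    then show "i = j" using \<phi>b[of i i] \<phi>b[of i j] l by (auto split: if_splits)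
  qed
  have "cfun.independent (?b ` {..<l})"
  proof (rule cfun.independent_if_scalars_zero)
    show "finite (?b ` {..<l})" by simp
    fix f x assume sum: "(\<Sum>x\<in>?b ` {..<l}. cscale (f x) x) = 0" and "x \<in> ?b ` {..<l}"
    then obtain i where i: "i < l" "x = ?b i" by blast
    have "(\<Sum>j<l. cscale (f (?b j)) (?b j)) = 0"
      using sum by (simp add: sum.reindex[OF inj])
    then have "0 = \<phi> i (\<Sum>j<l. cscale (f (?b j)) (?b j))" by (simp add: \<phi>_def)
    also have "\<dots> = (\<Sum>j<l. f (?b j) * \<phi> i (?b j))"
      unfolding \<phi>_def cscale_sum_apply sum_distrib_left
      by (subst sum.swap) (simp add: mult_ac)
    also have "\<dots> = (\<Sum>j<l. if j = i then f (?b j) else 0)"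
      using i l by (intro sum.cong refl) (auto simp: \<phi>b)
    finally show "f x = 0" using i by simp
  qed
  moreover have "cvec ` L \<subseteq> cfun.span (?b ` {..<l})"
  proof
    fix v assume "v \<in> cvec ` L"
    then obtain r s where r: "v = cvec r" "\<forall>j\<ge>l. s j = 0" "r = matvec n B s" using coord by blast
    have "v = (\<Sum>j<l. cscale (of_int (s j)) (?b j))"
    proof
      fix a
      have "(\<Sum>j<n. B a j * s j) = (\<Sum>j<l. B a j * s j)"
        using r l by (intro sum.mono_neutral_right) auto
      then show "v a = (\<Sum>j<l. cscale (of_int (s j)) (?b j)) a"
        unfolding cscale_sum_apply using r by (simp add: cvec_def matvec_def int_col_def mult.commute)
    qed
    moreover have "(\<Sum>j<l. cscale (of_int (s j)) (?b j)) \<in> cfun.span (?b ` {..<l})"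
      by (intro cfun.span_sum cfun.span_scale cfun.span_base imageI)
    ultimately show "v \<in> cfun.span (?b ` {..<l})" by simp
  qed
  then have "cfun.span (?b ` {..<l}) = cfun.span (cvec ` L)"
    using col by (intro antisym cfun.span_minimal) (auto simp: cfun.subspace_span)
  ultimately have "cfun.dim (cvec ` L) = card (?b ` {..<l})"
    by (intro cfun.dim_eq_card)
  then show ?thesis unfolding span_dim_def by (simp add: card_image[OF inj])
qed

section \<open>Central operators and weight spaces\<close>

locale irreducible_toroidal_module =
  fixes n :: nat
    and sg :: "complex \<Rightarrow> 'g::ab_group_add \<Rightarrow> 'g" and br :: "'g \<Rightarrow> 'g \<Rightarrow> 'g"
    and form :: "'g \<Rightarrow> 'g \<Rightarrow> complex" and h :: "'g set"
    and sv :: "complex \<Rightarrow> 'v::ab_group_add \<Rightarrow> 'v"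
    and rg :: "'g \<Rightarrow> (nat \<Rightarrow> int) \<Rightarrow> 'v \<Rightarrow> 'v"
    and rK :: "(nat \<Rightarrow> int) \<Rightarrow> nat \<Rightarrow> 'v \<Rightarrow> 'v"
    and rd :: "nat \<Rightarrow> 'v \<Rightarrow> 'v"
  assumes simple: "simple_lie_algebra sg br"
    and cartan: "cartan_subalgebra sg br h"
    and form: "invariant_form sg br form"
    and tau_module: "tau_module n sg br form sv rg rK rd"
    and irred: "tau_irreducible n sv rg rK rd"
    and fdwt: "fd_weight_quot n sv {0} h {..<n} rg rK rd"
begin

section \<open>Identities of the module and the Lie algebra\<close>

sublocale V: complex_vector_space sv
  using tau_module unfolding tau_module_def complex_vector_space_def by blast

sublocale g: complex_vector_space sg
  using simple unfolding simple_lie_algebra_def lie_algebra_def complex_vector_space_def by blast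

abbreviation lin :: "('v \<Rightarrow> 'v) \<Rightarrow> bool" where "lin f \<equiv> Vector_Spaces.linear sv sv f"

abbreviation central :: "(nat \<Rightarrow> int) \<Rightarrow> ('v \<Rightarrow> 'v) \<Rightarrow> bool" where
  "central m z \<equiv> central_op n sv rg rK rd m z"

lemma lin_add: "lin f \<Longrightarrow> f (v + w) = f v + f w"
  and lin_scale: "lin f \<Longrightarrow> f (sv c v) = sv c (f v)"
  and lin_zero: "lin f \<Longrightarrow> f 0 = 0"
  and lin_diff: "lin f \<Longrightarrow> f (v - w) = f v - f w"
  by (simp_all add: linear_iff_module_hom module_hom.add module_hom.scale module_hom.zero module_hom.diff)

lemma lin_sum: "lin f \<Longrightarrow> f (sum x A) = (\<Sum>i\<in>A. f (x i))"
  by (simp add: linear_iff_module_hom module_hom.sum)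

lemma lin_compose: "lin f \<Longrightarrow> lin f' \<Longrightarrow> lin (\<lambda>v. f (f' v))"
  by (intro V.linear_selfI) (simp_all add: lin_add lin_scale)

lemma lin_rg: "zvec n r \<Longrightarrow> lin (rg X r)"
  and lin_rK: "zvec n r \<Longrightarrow> i < n \<Longrightarrow> lin (rK r i)"
  and lin_rd: "i < n \<Longrightarrow> lin (rd i)"
  using tau_module unfolding tau_module_def lin_op_def by simp_all

lemma rg_add: "zvec n r \<Longrightarrow> rg (X + Y) r v = rg X r v + rg Y r v"
  and rg_scale: "zvec n r \<Longrightarrow> rg (sg c X) r v = sv c (rg X r v)"
  and rg_rg: "zvec n r \<Longrightarrow> zvec n s \<Longrightarrow> rg X r (rg Y s v) - rg Y s (rg X r v) =
        rg (br X Y) (zadd r s) v + sv (form X Y) (\<Sum>i<n. sv (of_int (r i)) (rK (zadd r s) i v))"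
  and rg_rK: "zvec n r \<Longrightarrow> zvec n m \<Longrightarrow> i < n \<Longrightarrow> rg X r (rK m i v) = rK m i (rg X r v)"
  and rK_rK: "zvec n m \<Longrightarrow> zvec n m' \<Longrightarrow> i < n \<Longrightarrow> j < n \<Longrightarrow> rK m i (rK m' j v) = rK m' j (rK m i v)"
  and rd_rg: "i < n \<Longrightarrow> zvec n r \<Longrightarrow> rd i (rg X r v) - rg X r (rd i v) = sv (of_int (r i)) (rg X r v)"
  and rd_rK: "i < n \<Longrightarrow> zvec n m \<Longrightarrow> j < n \<Longrightarrow> rd i (rK m j v) - rK m j (rd i v) = sv (of_int (m i)) (rK m j v)"
  and rd_rd: "i < n \<Longrightarrow> j < n \<Longrightarrow> rd i (rd j v) = rd j (rd i v)"
  using tau_module unfolding tau_module_def by simp_all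

lemma zvec_zzero [simp]: "zvec n zzero" by (simp add: zvec_def zzero_def)

lemma rg_zero: "zvec n r \<Longrightarrow> rg 0 r v = 0"
  using rg_scale[of r 0 0 v] by simp

text \<open>The central term is absent because \<open>d(t^0) t^s = 0\<close>.\<close>

lemma rg_zzero_rg: "zvec n s \<Longrightarrow> rg X zzero (rg Y s v) - rg Y s (rg X zzero v) = rg (br X Y) s v"
  using rg_rg[of zzero s X Y v] by (simp add: zzero_def zadd_def zvec_def)

lemma br_add_left: "br (x + y) z = br x z + br y z"
  and br_scale_left: "br (sg c x) y = sg c (br x y)"
  and br_add_right: "br x (y + z) = br x y + br x z"
  and br_scale_right: "br x (sg c y) = sg c (br x y)"
  and br_self: "br x x = 0"
  and jacobi: "br x (br y z) + br y (br z x) + br z (br x y) = 0"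
  using simple unfolding simple_lie_algebra_def lie_algebra_def by simp_all

lemma br_antisym: "br x y = - br y x"
proof -
  have "br (x + y) (x + y) = br y x + br x y" unfolding br_add_left br_add_right by (simp add: br_self)
  then show ?thesis by (simp add: br_self eq_neg_iff_add_eq_0 add.commute)
qed

lemma form_add_left: "form (x + y) z = form x z + form y z"
  and form_scale_left: "form (sg c x) y = c * form x y"
  and form_sym: "form x y = form y x"
  and form_invariant: "form (br x y) z = form x (br y z)"
  and form_nondegenerate: "(\<And>y. form x y = 0) \<Longrightarrow> x = 0"
  using form unfolding invariant_form_def by metis+

lemma lie_ideal_trivial: "lie_ideal sg br I \<Longrightarrow> I = {0} \<or> I = UNIV"
  using simple unfolding simple_lie_algebra_def by blast

lemma nonabelian: "\<exists>x y. br x y \<noteq> 0"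
  using simple unfolding simple_lie_algebra_def by blast

lemma submodule_trivial:
  assumes "V.subspace W"
    "\<And>X r v. zvec n r \<Longrightarrow> v \<in> W \<Longrightarrow> rg X r v \<in> W"
    "\<And>m i v. zvec n m \<Longrightarrow> i < n \<Longrightarrow> v \<in> W \<Longrightarrow> rK m i v \<in> W"
    "\<And>i v. i < n \<Longrightarrow> v \<in> W \<Longrightarrow> rd i v \<in> W"
  shows "W = {0} \<or> W = UNIV"
proof -
  have "V.subspace W \<longrightarrow> (\<forall>X r. zvec n r \<longrightarrow> rg X r ` W \<subseteq> W) \<longrightarrow>
        (\<forall>m i. zvec n m \<longrightarrow> i < n \<longrightarrow> rK m i ` W \<subseteq> W) \<longrightarrow>
        (\<forall>i<n. rd i ` W \<subseteq> W) \<longrightarrow> W = {0} \<or> W = UNIV"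
    using irred unfolding tau_irreducible_def by blast
  then show ?thesis using assms by (simp add: image_subset_iff)
qed

section \<open>Central operators\<close>

lemma centralD:
  assumes "central m z"
  shows "lin z" "\<And>X r v. zvec n r \<Longrightarrow> z (rg X r v) = rg X r (z v)"
    "\<And>s j v. zvec n s \<Longrightarrow> j < n \<Longrightarrow> z (rK s j v) = rK s j (z v)"
    "\<And>i v. i < n \<Longrightarrow> rd i (z v) = z (rd i v) + sv (of_int (m i)) (z v)"
  using assms unfolding central_op_def lin_op_def by (auto simp: diff_eq_eq add.commute)

lemma centralI:
  assumes "lin z" "\<And>X r v. zvec n r \<Longrightarrow> z (rg X r v) = rg X r (z v)"
    "\<And>s j v. zvec n s \<Longrightarrow> j < n \<Longrightarrow> z (rK s j v) = rK s j (z v)"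
    "\<And>i v. i < n \<Longrightarrow> rd i (z v) = z (rd i v) + sv (of_int (m i)) (z v)"
  shows "central m z"
  using assms unfolding central_op_def lin_op_def by simp

text \<open>Schur's lemma. Although \<open>z\<close> does not commute with \<open>rd i\<close>, the
  commutator is a multiple of \<open>z\<close>, so kernel and image are still stable under
  \<open>rd i\<close>.\<close>

lemma central_bij:
  assumes z: "central m z" and nz: "z v0 \<noteq> 0"
  shows "bij z"
proof -
  note zD = centralD[OF z]
  have "{v. z v = 0} = {0} \<or> {v. z v = 0} = UNIV"
  proof (rule submodule_trivial)
    fix i v assume "i < n" "v \<in> {v. z v = 0}"
    then show "rd i v \<in> {v. z v = 0}" using zD(4)[of i v] by (simp add: lin_zero[OF lin_rd])
  qed (auto simp: V.subspace_def lin_zero lin_add lin_scale zD lin_rg lin_rK)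
  then have ker: "z v = 0 \<Longrightarrow> v = 0" for v using nz by auto
  have "inj z"
  proof (rule injI)
    fix v w assume "z v = z w"
    then have "z (v - w) = 0" by (simp add: lin_diff[OF zD(1)])
    then show "v = w" using ker by fastforce
  qed
  moreover have "range z = {0} \<or> range z = UNIV"
  proof (rule submodule_trivial)
    show "V.subspace (range z)"
      unfolding V.subspace_def
      by (auto simp: lin_add[OF zD(1), symmetric] lin_scale[OF zD(1), symmetric]
          intro: image_eqI[of _ _ 0] simp: lin_zero[OF zD(1)])
    fix i v assume "i < n" "v \<in> range z"
    then obtain w where "v = z w" by blast
    then have "rd i v = z (rd i w + sv (of_int (m i)) w)"
      using \<open>i < n\<close> by (simp add: zD(4) lin_add[OF zD(1)] lin_scale[OF zD(1)])
    then show "rd i v \<in> range z" by blast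
  qed (use zD(2,3)[symmetric] in auto)
  then have "surj z" using nz by auto
  ultimately show ?thesis by (simp add: bij_def)
qed

lemma central_inv:
  assumes z: "central m z" and "bij z"
  shows "central (\<lambda>j. - m j) (inv z)"
proof -
  note zD = centralD[OF z]
  have inj: "z v = z w \<Longrightarrow> v = w" for v w using \<open>bij z\<close> by (auto simp: bij_def dest: injD)
  have zi: "z (inv z v) = v" for v using \<open>bij z\<close> by (simp add: bij_is_surj surj_f_inv_f)
  show ?thesis
  proof (rule centralI)
    show "lin (inv z)"
      by (rule V.linear_selfI; rule inj) (simp_all add: zi lin_add[OF zD(1)] lin_scale[OF zD(1)])
    show "inv z (rg X r v) = rg X r (inv z v)" if "zvec n r" for X r v
      by (rule inj) (simp add: zi zD that)
    show "inv z (rK r i v) = rK r i (inv z v)" if "zvec n r" "i < n" for r i v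
      by (rule inj) (simp add: zi zD that)
    show "rd i (inv z v) = inv z (rd i v) + sv (of_int (- m i)) (inv z v)" if "i < n" for i v
    proof (rule inj)
      have "z (rd i (inv z v)) = rd i v - sv (of_int (m i)) v"
        using zD(4)[OF that, of "inv z v"] by (simp add: zi)
      then show "z (rd i (inv z v)) = z (inv z (rd i v) + sv (of_int (- m i)) (inv z v))"
        by (simp add: lin_diff[OF zD(1)] lin_scale[OF zD(1)] zi)
    qed
  qed
qed

lemma central_comp:
  assumes z: "central m z" and z': "central m' z'"
  shows "central (\<lambda>j. m j + m' j) (z \<circ> z')"
proof -
  note zD = centralD[OF z] centralD[OF z']
  show ?thesis
    by (rule centralI)
      (simp_all add: lin_compose zD comp_def lin_add[OF zD(1)] lin_scale[OF zD(1)] V.scale_left_distrib add_ac)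
qed

lemma central_id: "central zzero id"
  by (rule centralI) (simp_all add: V.linear_selfI zzero_def)

text \<open>The coefficients are arbitrary so as to cover both \<open>d(t^r) t^s\<close> with
  \<open>r + s = m\<close> and the twisted operators \<open>tw_K\<close>, whose coefficients are
  columns of \<open>B\<close>.\<close>

lemma central_K_combination:
  assumes "zvec n m"
  shows "central m (\<lambda>v. \<Sum>i<n. sv (c i) (rK m i v))"
proof (rule centralI)
  show "lin (\<lambda>v. \<Sum>i<n. sv (c i) (rK m i v))"
    by (rule V.linear_selfI)
      (simp_all add: lin_add lin_scale lin_rK[OF assms] V.scale_right_distrib sum.distrib
        V.scale_sum_right mult.commute)
  show "(\<Sum>i<n. sv (c i) (rK m i (rg X r v))) = rg X r (\<Sum>i<n. sv (c i) (rK m i v))" if "zvec n r" for X r v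
    by (simp add: lin_sum[OF lin_rg[OF that]] lin_scale[OF lin_rg[OF that]] rg_rK[OF that assms])
  show "(\<Sum>i<n. sv (c i) (rK m i (rK s j v))) = rK s j (\<Sum>i<n. sv (c i) (rK m i v))"
    if "zvec n s" "j < n" for s j v
    using rK_rK[OF that(1) assms that(2)]
    by (simp add: lin_sum[OF lin_rK[OF that]] lin_scale[OF lin_rK[OF that]])
  show "rd j (\<Sum>i<n. sv (c i) (rK m i v)) =
      (\<Sum>i<n. sv (c i) (rK m i (rd j v))) + sv (of_int (m j)) (\<Sum>i<n. sv (c i) (rK m i v))" if "j < n" for j v
  proof -
    have "rd j (rK m i v) = rK m i (rd j v) + sv (of_int (m j)) (rK m i v)" if "i < n" for i
      using rd_rK[OF \<open>j < n\<close> assms that, of v] by (simp add: algebra_simps)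
    then show ?thesis
      by (simp add: lin_sum[OF lin_rd[OF that]] lin_scale[OF lin_rd[OF that]] V.scale_right_distrib
          sum.distrib V.scale_sum_right mult.commute)
  qed
qed

lemma central_rK:
  assumes "zvec n m" "i < n"
  shows "central m (rK m i)"
proof (rule centralI)
  show "rd j (rK m i v) = rK m i (rd j v) + sv (of_int (m j)) (rK m i v)" if "j < n" for j v
    using rd_rK[OF that assms, of v] by (simp add: diff_eq_eq add.commute)
qed (use assms rK_rK in \<open>auto simp: lin_rK rg_rK\<close>)

text \<open>Two central operators need not commute a priori, but the relation \<open>z\<^sub>i = 1\<close> imposed on the quotient
  requires commuting operators. Every nonzero \<open>t\<^sup>m K\<^sub>i\<close> is bicentral.\<close>
definition bicentral :: "(nat \<Rightarrow> int) \<Rightarrow> ('v \<Rightarrow> 'v) \<Rightarrow> bool" where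
  "bicentral m z \<longleftrightarrow> central m z \<and> bij z \<and> (\<forall>m' z' v. central m' z' \<longrightarrow> z (z' v) = z' (z v))"

definition central_degrees :: "(nat \<Rightarrow> int) set" where
  "central_degrees = {m. zvec n m \<and> (\<exists>z. bicentral m z)}"

text \<open>Central operators commute with the action of the \<open>rK m i\<close> by definition,
  which is the extra condition for bicentrality.\<close>

lemma bicentral_rK:
  assumes "zvec n m" "i < n" "rK m i v \<noteq> 0"
  shows "bicentral m (rK m i)"
  unfolding bicentral_def
  using central_rK[OF assms(1,2)] central_bij[of m "rK m i", OF _ assms(3)] centralD(3)[OF _ assms(1,2)] by auto

text \<open>Quotients cover products and inverses at once: with \<open>zzero\<close> as a member,
  closure under differences makes \<open>central_degrees\<close> a group.\<close>

lemma bicentral_divide: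
  assumes z: "bicentral m z" and z': "bicentral m' z'"
  shows "bicentral (\<lambda>j. m j - m' j) (z \<circ> inv z')"
proof -
  have "inv z' (y v) = y (inv z' v)" if "central l y" for y v l
  proof -
    have "z' (y (inv z' v)) = y v"
      using z' that unfolding bicentral_def by (simp add: bij_is_surj surj_f_inv_f)
    then show ?thesis
      using z' unfolding bicentral_def by (metis bij_inv_eq_iff)
  qed
  moreover have "central (\<lambda>j. m j - m' j) (z \<circ> inv z')"
    using central_comp[OF _ central_inv] z z' unfolding bicentral_def by fastforce
  ultimately show ?thesis
    using z z' unfolding bicentral_def by (auto simp: bij_comp bij_imp_bij_inv)
qed

lemma zzero_central_degree: "zzero \<in> central_degrees"
  unfolding central_degrees_def bicentral_def using central_id by auto

lemma diff_central_degree: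
  "r \<in> central_degrees \<Longrightarrow> s \<in> central_degrees \<Longrightarrow> (\<lambda>j. r j - s j) \<in> central_degrees"
  unfolding central_degrees_def using bicentral_divide[of r _ s] by (fastforce simp: zvec_def)

section \<open>Weight spaces\<close>

definition wt :: "('g \<Rightarrow> complex) \<Rightarrow> (nat \<Rightarrow> complex) \<Rightarrow> (nat \<Rightarrow> complex) \<Rightarrow> 'v set" where
  "wt lam c a = {v. (\<forall>x\<in>h. rg x zzero v = sv (lam x) v) \<and>
         (\<forall>i<n. rK zzero i v = sv (c i) v) \<and> (\<forall>j<n. rd j v = sv (a j) v)}"

lemma wt_space_mod_zero: "wt_space_mod n sv {0} h {..<n} rg rK rd lam c a = wt lam c a"
  unfolding wt_space_mod_def wt_def by auto

lemma span_wt: "v \<in> V.span (\<Union>lam c a. wt lam c a)"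
proof -
  have "v \<in> V.span ({0} \<union> (\<Union>lam c a. wt lam c a))"
    using fdwt unfolding fd_weight_quot_def wt_space_mod_zero by blast
  then show ?thesis by simp
qed

lemma wt_finite_dim: "\<exists>F. finite F \<and> wt lam c a \<subseteq> V.span F"
proof -
  have "\<exists>F. finite F \<and> wt lam c a \<subseteq> V.span (F \<union> {0})"
    using fdwt unfolding fd_weight_quot_def wt_space_mod_zero by blast
  then show ?thesis by simp
qed

lemma subspace_wt: "V.subspace (wt lam c a)"
  unfolding V.subspace_def wt_def
  by (auto simp: lin_zero lin_add lin_scale lin_rg lin_rK lin_rd V.scale_right_distrib mult.commute)

lemma nonzero_weight_vector: obtains lam c a v where "v \<in> wt lam c a" "v \<noteq> 0"
proof -
  have "\<exists>lam c a v. v \<in> wt lam c a \<and> v \<noteq> 0"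
  proof (rule ccontr)
    assume "\<not> ?thesis"
    then have "(\<Union>lam c a. wt lam c a) \<subseteq> {0}" by blast
    then have "V.span (\<Union>lam c a. wt lam c a) \<subseteq> V.span {0}" by (rule V.span_mono)
    then have "UNIV = {0 :: 'v}" using span_wt by auto
    moreover have "UNIV \<noteq> {0 :: 'v}" using irred unfolding tau_irreducible_def by blast
    ultimately show False by contradiction
  qed
  then show ?thesis using that by blast
qed

lemma lin_eq_zero_on_weights:
  assumes "lin f" "\<And>lam c a v. v \<in> wt lam c a \<Longrightarrow> f v = 0"
  shows "f v = 0"
  using span_wt[of v]
  by (rule V.span_induct) (use assms in \<open>auto simp: V.subspace_def lin_zero lin_add lin_scale\<close>)

lemma wt_invariant:
  assumes "lin f" "\<And>x v. x \<in> h \<Longrightarrow> rg x zzero (f v) = f (rg x zzero v)"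
    "\<And>i v. i < n \<Longrightarrow> rK zzero i (f v) = f (rK zzero i v)"
    "\<And>i v. i < n \<Longrightarrow> rd i (f v) = f (rd i v)"
  shows "f ` wt lam c a \<subseteq> wt lam c a"
  using assms by (auto simp: wt_def lin_scale)

section \<open>The invariant form on the Cartan subalgebra\<close>

text \<open>On a weight vector both \<open>x\<close> and \<open>y\<close> act by scalars, so their
  commutator kills it, and weight vectors span \<open>V\<close>. In the faithful case this turns the
  nilpotent \<open>h\<close> into an abelian one.\<close>

lemma cartan_br_acts_zero:
  assumes "x \<in> h" "y \<in> h"
  shows "rg (br x y) zzero v = 0"
proof (rule lin_eq_zero_on_weights[where f = "rg (br x y) zzero"])
  fix lam c a v assume "v \<in> wt lam c a"
  then have "rg x zzero v = sv (lam x) v" "rg y zzero v = sv (lam y) v"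
    using assms unfolding wt_def by auto
  then have "rg x zzero (rg y zzero v) = rg y zzero (rg x zzero v)"
    by (simp add: lin_scale[OF lin_rg] mult.commute)
  then show "rg (br x y) zzero v = 0" using rg_zzero_rg[of zzero x y v] by simp
qed (simp add: lin_rg)

text \<open>For a weight vector \<open>v\<close>, the vector \<open>[x, y] v\<close> equals
  \<open>(x - lam x) (y v)\<close>, and it is annihilated by \<open>x - lam x\<close> because
  \<open>[x, [x, y]] = 0\<close>. Since \<open>x\<close> is diagonalizable on \<open>V\<close>, it
  is zero.\<close>

lemma ad_cartan_semisimple:
  assumes faithful: "\<And>X. (\<And>v. rg X zzero v = 0) \<Longrightarrow> X = 0"
    and x: "x \<in> h" and sq: "br x (br x y) = 0"
  shows "br x y = 0"
proof (rule faithful, rule lin_eq_zero_on_weights[where f = "rg (br x y) zzero"])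
  fix lam c a v assume "v \<in> wt lam c a"
  then have xv: "rg x zzero v = sv (lam x) v" using x unfolding wt_def by auto
  let ?u = "rg (br x y) zzero v"
  show "?u = 0"
  proof (rule V.eigenvector_in_image_zero)
    show "lin (rg x zzero)" by (simp add: lin_rg)
    have "(\<Union>lam c a. wt lam c a) \<subseteq> (\<Union>\<mu>. {v. rg x zzero v = sv \<mu> v})"
      using x unfolding wt_def by blast
    then show "v \<in> V.span (\<Union>\<mu>. {v. rg x zzero v = sv \<mu> v})" for v
      by (rule subsetD[OF V.span_mono span_wt])
    show "?u = rg x zzero (rg y zzero v) - sv (lam x) (rg y zzero v)"
      using rg_zzero_rg[of zzero x y v] by (simp add: xv lin_scale[OF lin_rg])
    have "rg x zzero ?u - rg (br x y) zzero (rg x zzero v) = 0"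
      using rg_zzero_rg[of zzero x "br x y" v] by (simp add: sq rg_zero)
    then show "rg x zzero ?u = sv (lam x) ?u" by (simp add: xv lin_scale[OF lin_rg])
  qed
qed (simp add: lin_rg)

lemma linear_br: "Vector_Spaces.linear sg sg (br x)"
  by (rule g.linear_selfI) (simp_all add: br_add_right br_scale_right)

lemma form_add_right: "form x (y + z) = form x y + form x z"
  using form_add_left[of y z x] by (simp add: form_sym)

lemma form_scale_right: "form x (sg c y) = c * form x y"
  using form_scale_left[of c y x] by (simp add: form_sym)

lemma br_zero_right: "br x 0 = 0" using br_scale_right[of x 0 0] by simp

lemma br_zero_left: "br 0 x = 0" using br_scale_left[of 0 0 x] by simp

lemma form_zero_left: "form 0 x = 0" using form_scale_left[of 0 0 x] by simp

lemma finite_dim_g: "\<exists>F. finite F \<and> g.span F = UNIV"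
  using simple unfolding simple_lie_algebra_def fin_dim_def by blast

text \<open>Induction on \<open>S\<close>: a \<open>Y\<close> centralizing \<open>S\<close> is
  replaced by a multiple of it plus an element of the image of \<open>ad x\<close>, chosen to
  commute with \<open>x\<close> too. The correction does not affect the pairing with
  \<open>X\<close>.\<close>

lemma form_nonzero_on_centralizer:
  assumes faithful: "\<And>X. (\<And>v. rg X zzero v = 0) \<Longrightarrow> X = 0"
    and X: "X \<in> h" "X \<noteq> 0" and S: "finite S" "S \<subseteq> h"
  shows "\<exists>Y. (\<forall>x\<in>S. br x Y = 0) \<and> form X Y \<noteq> 0"
  using S
proof (induction S rule: finite_induct)
  case empty
  then show ?case using form_nondegenerate X by blast
next
  case (insert x S)
  then obtain Y where Y: "\<forall>x\<in>S. br x Y = 0" "form X Y \<noteq> 0" by blast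
  have comm: "br x y = 0" if "x \<in> h" "y \<in> h" for x y
    by (rule faithful) (rule cartan_br_acts_zero[OF that])
  define U where "U = {y. \<forall>x\<in>S. br x y = 0}"
  have subU: "g.subspace U"
    unfolding U_def g.subspace_def by (simp add: br_add_right br_scale_right br_zero_right)
  \<comment> \<open>By the Jacobi identity, since \<open>x\<close> commutes with \<open>S\<close>;
    this keeps the correction inside the centralizer of \<open>S\<close>.\<close>
  have "br x ` U \<subseteq> U"
  proof (clarsimp simp: U_def)
    fix y x' assume y: "\<forall>x\<in>S. br x y = 0" and x': "x' \<in> S"
    then have "br y x' = 0" using br_antisym[of y x'] by simp
    moreover have "br x' x = 0" using comm insert.prems x' by blast
    ultimately show "br x' (br x y) = 0" using jacobi[of x' x y] by (simp add: br_zero_right)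
  qed
  have "Y \<in> U" using Y by (simp add: U_def)
  obtain F where "finite F" "g.span F = UNIV" using finite_dim_g by blast
  then obtain p where p: "p \<noteq> 0" "g.poly_op (br x) p Y = 0"
    "\<And>q. q \<noteq> 0 \<Longrightarrow> g.poly_op (br x) q Y = 0 \<Longrightarrow> degree p \<le> degree q"
    using g.minimal_annihilating_poly[of F U "br x" Y] \<open>br x ` U \<subseteq> U\<close> \<open>Y \<in> U\<close> by auto
  have orth: "form X (br x w) = 0" for w
    using form_invariant[of X x w] comm[of X x] X insert.prems by (simp add: form_zero_left)
  note pC = g.poly_op_pCons[OF linear_br]
  obtain a q where q: "p = pCons a q" by (cases p) auto
  \<comment> \<open>Minimality and \<open>ker (ad x)\<^sup>2 = ker (ad x)\<close> leave at most a simple root at \<open>0\<close>,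
    so \<open>Y\<close> lies in \<open>ker (ad x) + im (ad x)\<close>, and \<open>X\<close> is orthogonal to the image.\<close>
  have "form X (sg a Y + br x (g.poly_op (br x) q Y)) = 0"
    using p(2) orth[of 0] by (simp add: q pC br_zero_right)
  then have a: "a = 0" using Y by (simp add: form_add_right form_scale_right orth)
  obtain b q' where q': "q = pCons b q'" by (cases q) auto
  let ?w = "g.poly_op (br x) q' Y"
  have ker: "br x (sg b Y + br x ?w) = 0" using p(2) by (simp add: q q' pC a)
  have b: "b \<noteq> 0"
  proof
    assume "b = 0"
    then have "br x (br x ?w) = 0" using ker by simp
    then have "br x ?w = 0" using ad_cartan_semisimple[OF faithful] insert.prems by blast
    then have "g.poly_op (br x) q Y = 0" by (simp add: q' pC \<open>b = 0\<close>)
    moreover have "q \<noteq> 0" using p(1) q a by auto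
    ultimately show False using p(3)[of q] by (simp add: q)
  qed
  have "?w \<in> U"
    using subU \<open>br x ` U \<subseteq> U\<close> \<open>Y \<in> U\<close> by (rule g.poly_op_invariant)
  then have "sg b Y + br x ?w \<in> U"
    using subU \<open>br x ` U \<subseteq> U\<close> \<open>Y \<in> U\<close> by (intro g.subspace_add g.subspace_scale) auto
  moreover have "form X (sg b Y + br x ?w) \<noteq> 0"
    using b Y by (simp add: form_add_right form_scale_right orth)
  ultimately show ?case using ker unfolding U_def by blast
qed

text \<open>A \<open>Y\<close> commuting with a finite basis of \<open>h\<close> centralizes
  \<open>h\<close>, hence normalizes it, hence lies in \<open>h\<close>.\<close>

lemma form_nonzero_on_cartan:
  assumes faithful: "\<And>X. (\<And>v. rg X zzero v = 0) \<Longrightarrow> X = 0"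
  obtains X Y where "X \<in> h" "Y \<in> h" "form X Y \<noteq> 0"
proof -
  have norm: "{x. \<forall>y\<in>h. br x y \<in> h} = h" and "g.subspace h"
    using cartan unfolding cartan_subalgebra_def by blast+
  have "h \<noteq> {0}"
  proof
    \<comment> \<open>Every element normalizes the zero subalgebra, so self-normalization would make
      the whole Lie algebra zero.\<close>
    assume h0: "h = {0}"
    then have "UNIV = h" using norm by (simp add: br_zero_right)
    then show False using nonabelian h0 by (metis UNIV_I singletonD)
  qed
  then obtain X where X: "X \<in> h" "X \<noteq> 0" using \<open>g.subspace h\<close> g.subspace_0 by blast
  obtain S where S: "S \<subseteq> h" "g.independent S" "h \<subseteq> g.span S"
    using g.basis_exists by metis
  obtain F where F: "finite F" "g.span F = UNIV" using finite_dim_g by blast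
  have "finite S" using g.independent_span_bound[OF F(1) S(2)] F(2) by simp
  then obtain Y where Y: "\<forall>x\<in>S. br x Y = 0" "form X Y \<noteq> 0"
    using form_nonzero_on_centralizer[OF faithful X] S by blast
  have "br x Y = 0" if "x \<in> h" for x
    using subsetD[OF S(3) that]
    by (rule g.span_induct)
      (use Y in \<open>auto simp: g.subspace_def br_add_left br_scale_left br_zero_left\<close>)
  then have "br Y x = 0" if "x \<in> h" for x using that br_antisym[of Y x] by simp
  then have "Y \<in> h" using norm g.subspace_0[OF \<open>g.subspace h\<close>] by auto
  then show ?thesis using that X Y by blast
qed

section \<open>Orthogonality of central charges and central degrees\<close>

text \<open>The elements acting as zero in every degree form an ideal. It contains all brackets,
  because \<open>[X, Y] t^r\<close> is the commutator of \<open>X t^0\<close> and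
  \<open>Y t^r\<close>, so it is everything.\<close>

lemma trivial_action:
  assumes "\<And>X v. rg X zzero v = 0" "zvec n r"
  shows "rg X r v = 0"
proof -
  let ?I = "{X. \<forall>r v. zvec n r \<longrightarrow> rg X r v = 0}"
  have brI: "br X Y \<in> ?I" for X Y
    using rg_zzero_rg[of _ X Y] assms(1) by (auto simp: lin_zero[OF lin_rg])
  have "lie_ideal sg br ?I"
    unfolding lie_ideal_def g.subspace_def using brI by (auto simp: rg_zero rg_add rg_scale)
  then have "?I = UNIV" using lie_ideal_trivial nonabelian brI by blast
  then show ?thesis using assms(2) by blast
qed

lemma faithful_or_trivial:
  obtains (faithful) "\<And>X. (\<And>v. rg X zzero v = 0) \<Longrightarrow> X = 0" | (trivial) "\<And>X v. rg X zzero v = 0"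
proof -
  let ?I = "{X. \<forall>v. rg X zzero v = 0}"
  have "lie_ideal sg br ?I"
    unfolding lie_ideal_def g.subspace_def
    using rg_zzero_rg[of zzero, symmetric] by (auto simp: rg_zero rg_add rg_scale lin_zero[OF lin_rg])
  then show ?thesis using lie_ideal_trivial[of ?I] that by blast
qed

text \<open>The sum is the action of \<open>d(t^r) t^(m - r)\<close>, the central term in the
  bracket of \<open>X t^r\<close> and \<open>Y t^(m - r)\<close>.\<close>

lemma central_degree_orthogonal:
  assumes r: "r \<in> central_degrees" and m: "zvec n m"
  shows "(\<Sum>i<n. sv (of_int (r i)) (rK m i v)) = 0"
proof (rule ccontr)
  define T where "T v = (\<Sum>i<n. sv (of_int (r i)) (rK m i v))" for v
  assume "\<not> ?thesis"
  then have nz: "T v \<noteq> 0" by (simp add: T_def)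
  have T: "central m T" unfolding T_def by (rule central_K_combination[OF m])
  have Tb: "bij T" using central_bij[OF T nz] .
  obtain z where z: "central r z" "bij z" and zT: "\<And>v. z (T v) = T (z v)" and zr: "zvec n r"
    using r T unfolding central_degrees_def bicentral_def by blast
  define s where "s = (\<lambda>j. m j - r j)"
  have s: "zvec n s" "zadd r s = m" using m zr by (auto simp: s_def zvec_def zadd_def)
  have comm: "rg X r (rg Y s w) - rg Y s (rg X r w) = rg (br X Y) m w + sv (form X Y) (T w)" for X Y w
    using rg_rg[OF zr s(1), of X Y w] unfolding s(2) T_def .
  show False
  proof (cases rule: faithful_or_trivial)
    \<comment> \<open>The commutator relation reduces to \<open>form X Y\<close> times the nonzero
      \<open>T v\<close>, so the form would vanish identically.\<close>
    case trivial
    have "form X Y = 0" for X Y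
      using comm[of X Y v] nz trivial_action[OF trivial] zr m s(1) by simp
    then have "X = 0" for X :: 'g by (simp add: form_nondegenerate)
    then show False using nonabelian by blast
  next
    case faithful
    obtain X Y where XY: "X \<in> h" "Y \<in> h" "form X Y \<noteq> 0"
      using form_nonzero_on_cartan[OF faithful] by blast
    have abelian: "br x y = 0" if "x \<in> h" "y \<in> h" for x y
      by (rule faithful) (rule cartan_br_acts_zero[OF that])
    have cancel: "z (inv z w) = w" "inv z (z w) = w" "T (inv T w) = w" "inv T (T w) = w" for w
      using z(2) Tb by (simp_all add: bij_is_surj bij_is_inj surj_f_inv_f)
    \<comment> \<open>In \<open>Q (P w)\<close> the operator \<open>inv T\<close> stands between
      \<open>z\<close> and \<open>inv z\<close>; they cancel because the bicentral \<open>z\<close>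
      commutes with \<open>T\<close>.\<close>
    have zTinv: "z (inv T (inv z w)) = inv T w" for w
      using zT[of "inv T (inv z w)"] cancel by metis
    note zi = centralD[OF central_inv[OF z]] and Ti = centralD[OF central_inv[OF T Tb]]
      and zD = centralD[OF z(1)]
    define P where "P w = rg X r (inv z w)" for w
    define Q where "Q w = rg Y s (z (inv T w))" for w
    have linP: "lin P" unfolding P_def by (intro lin_compose[OF lin_rg[OF zr] zi(1)])
    have linQ: "lin Q"
      unfolding Q_def by (intro lin_compose[OF lin_rg[OF s(1)]] lin_compose[OF zD(1) Ti(1)])
    have rgc: "rg x zzero (rg y r w) = rg y r (rg x zzero w)" if "x \<in> h" "y \<in> h" "zvec n r" for x y r w
      using rg_zzero_rg[OF that(3), of x y w] abelian[OF that(1,2)] by (simp add: rg_zero[OF that(3)])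
    have rdc: "rd i (rg y r w) = rg y r (rd i w) + sv (of_int (r i)) (rg y r w)" if "i < n" "zvec n r" for i y r w
      using rd_rg[OF that, of y w] by (simp add: diff_eq_eq add.commute)
    have rs: "lin (rg X r)" "lin (rg Y s)" using lin_rg zr s(1) by auto
    obtain lam c a u where u: "u \<in> wt lam c a" "u \<noteq> 0" by (rule nonzero_weight_vector)
    have "P ` wt lam c a \<subseteq> wt lam c a"
      by (rule wt_invariant[OF linP])
        (simp_all add: P_def rgc XY zr zi rg_rK[symmetric] rdc lin_diff[OF rs(1)] lin_scale[OF rs(1)])
    moreover have si: "complex_of_int (s i) = of_int (m i) - of_int (r i)" for i by (simp add: s_def)
    have "Q ` wt lam c a \<subseteq> wt lam c a"
      by (rule wt_invariant[OF linQ])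
        (simp_all add: Q_def rgc XY s(1) zD Ti rg_rK[symmetric] rdc lin_add[OF rs(2)] lin_scale[OF rs(2)]
          lin_diff[OF rs(2)] lin_add[OF zD(1)] lin_diff[OF zD(1)] lin_scale[OF zD(1)]
          si V.scale_left_diff_distrib)
    moreover have "P (Q w) - Q (P w) = sv (form X Y) w" for w
    proof -
      have "P (Q w) = rg X r (rg Y s (inv T w))"
        by (simp add: P_def Q_def zi(2)[OF s(1)] cancel)
      moreover have "Q (P w) = rg Y s (rg X r (inv T w))"
        by (simp add: P_def Q_def zD(2)[OF zr] Ti(2)[OF zr] zTinv)
      ultimately show ?thesis
        using comm[of X Y "inv T w"] abelian[OF XY(1,2)] by (simp add: rg_zero[OF m] cancel)
    qed
    moreover obtain F where "finite F" "wt lam c a \<subseteq> V.span F" using wt_finite_dim by blast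
    ultimately have "form X Y = 0"
      by (intro V.scalar_commutator_zero[OF linP linQ _ subspace_wt _ _ _ u])
    then show False using XY by blast
  qed
qed

end

section \<open>The graded quotient\<close>

definition bij_pow :: "('b \<Rightarrow> 'b) \<Rightarrow> int \<Rightarrow> 'b \<Rightarrow> 'b" where
  "bij_pow z q = (if q \<ge> 0 then z ^^ nat q else inv z ^^ nat (- q))"

lemma bij_pow_0 [simp]: "bij_pow z 0 v = v"
  by (simp add: bij_pow_def)

lemma bij_pow_add_1:
  assumes "bij z"
  shows "bij_pow z (q + 1) v = bij_pow z q (z v)"
proof (cases "q \<ge> 0")
  case True
  then have "nat (q + 1) = Suc (nat q)" by simp
  then show ?thesis using True by (simp add: bij_pow_def funpow_swap1)
next
  case False
  then have "nat (- q) = Suc (nat (- (q + 1)))" by simp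
  then have "bij_pow z q (z v) = (inv z ^^ nat (- (q + 1))) (inv z (z v))"
    using False by (simp add: bij_pow_def funpow_swap1)
  then show ?thesis using False assms by (auto simp: bij_pow_def bij_is_inj)
qed

lemma bij_pow_induct:
  assumes "bij z" "P v" "\<And>v. P v \<Longrightarrow> P (z v)" "\<And>v. P v \<Longrightarrow> P (inv z v)"
  shows "P (bij_pow z q v)"
proof -
  have "P ((f ^^ i) v)" if "\<And>v. P v \<Longrightarrow> P (f v)" for f and i :: nat
    using that assms(2) by (induction i) auto
  then show ?thesis using assms(3,4) by (simp add: bij_pow_def)
qed

lemma inv_commute:
  assumes "bij z" "\<And>v. f (z v) = z (f v)"
  shows "f (inv z v) = inv z (f v)"
  using assms by (metis bij_inv_eq_iff)

lemma bij_pow_commute: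
  assumes "bij z" "\<And>v. f (z v) = z (f v)"
  shows "f (bij_pow z q v) = bij_pow z q (f v)"
proof -
  have "f ((y ^^ i) v) = (y ^^ i) (f v)" if "\<And>v. f (y v) = y (f v)" for y and i :: nat
    using that by (induction i) auto
  then show ?thesis using assms(2) inv_commute[of z f, OF assms] by (simp add: bij_pow_def)
qed

text \<open>The product of the powers \<open>z i\<close> to the exponent \<open>- q i\<close> for
  \<open>i < k\<close>. The minus sign fits its use: \<open>q i\<close> counts the steps of
  \<open>z i\<close> that are to be undone.\<close>

fun shift_op :: "(nat \<Rightarrow> 'b \<Rightarrow> 'b) \<Rightarrow> (nat \<Rightarrow> int) \<Rightarrow> nat \<Rightarrow> 'b \<Rightarrow> 'b" where
  "shift_op z q 0 v = v"
| "shift_op z q (Suc i) v = bij_pow (z i) (- q i) (shift_op z q i v)"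

lemma shift_op_commute:
  assumes "\<And>i. i < k \<Longrightarrow> bij (z i)" "\<And>i v. i < k \<Longrightarrow> f (z i v) = z i (f v)"
  shows "f (shift_op z q k v) = shift_op z q k (f v)"
  using assms by (induction k) (auto simp: bij_pow_commute)

lemma shift_op_cong: "(\<And>i. i < k \<Longrightarrow> q i = q' i) \<Longrightarrow> shift_op z q k v = shift_op z q' k v"
  by (induction k) auto

lemma shift_op_zero: "(\<And>i. i < k \<Longrightarrow> q i = 0) \<Longrightarrow> shift_op z q k v = v"
  by (induction k) auto

lemma shift_op_increment:
  assumes "\<And>i. i < k \<Longrightarrow> bij (z i)" "\<And>i j v. i < k \<Longrightarrow> j < k \<Longrightarrow> z i (z j v) = z j (z i v)"
    and "i < k" "q' i = q i + 1" "\<And>j. j < k \<Longrightarrow> j \<noteq> i \<Longrightarrow> q' j = q j"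
  shows "shift_op z q' k (z i v) = shift_op z q k v"
  using assms
proof (induction k)
  case (Suc k)
  show ?case
  proof (cases "i = k")
    case True
    \<comment> \<open>The extra \<open>z i\<close> has to pass the factors with smaller index, which
      act first, to meet its own power.\<close>
    have "shift_op z q' k (z i v) = z i (shift_op z q k v)"
      using Suc.prems True shift_op_commute[of k z "z i" q v] shift_op_cong[of k q' q] by simp
    then show ?thesis
      using Suc.prems True bij_pow_add_1[of "z k" "- q k - 1" "shift_op z q k v"] by simp
  next
    case False
    then show ?thesis using Suc by simp
  qed
qed simp

context irreducible_toroidal_module
begin

lemma lin_span_into:
  assumes "lin f" "\<And>x. x \<in> A \<Longrightarrow> f x \<in> V.span A'" "x \<in> V.span A"
  shows "f x \<in> V.span A'"
  using assms(3)
proof (rule V.span_induct)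
  show "V.subspace {x. f x \<in> V.span A'}"
    unfolding V.subspace_def
    by (auto simp: lin_zero[OF assms(1)] lin_add[OF assms(1)] lin_scale[OF assms(1)]
        intro: V.span_add V.span_scale V.span_zero)
qed (use assms in auto)

lemma lin_eq_on_span:
  assumes "lin f" "lin g" "\<And>x. x \<in> A \<Longrightarrow> f x = g x" "x \<in> V.span A"
  shows "f x = g x"
  using assms(4)
  by (rule V.span_induct) (use assms in \<open>auto simp: V.subspace_def lin_zero lin_add lin_scale\<close>)

section \<open>The grading by the operators \<open>rd j\<close>\<close>

definition grade :: "(nat \<Rightarrow> complex) \<Rightarrow> (nat \<Rightarrow> int) \<Rightarrow> 'v set" where
  "grade a s = {v. \<forall>j<n. rd j v = sv (a j + of_int (s j)) v}"

lemma subspace_grade: "V.subspace (grade a s)"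
  unfolding V.subspace_def grade_def
  by (auto simp: lin_zero lin_add lin_scale lin_rd V.scale_right_distrib mult.commute)

lemma grade_shift:
  assumes "\<And>i v. i < n \<Longrightarrow> rd i (f v) = f (rd i v) + sv (of_int (m i)) (f v)" "lin f" "v \<in> grade a s"
  shows "f v \<in> grade a (zadd s m)"
  unfolding grade_def
proof (safe)
  fix j assume j: "j < n"
  have "rd j v = sv (a j + of_int (s j)) v" using assms(3) j unfolding grade_def by blast
  then have "rd j (f v) = sv (a j + of_int (s j)) (f v) + sv (of_int (m j)) (f v)"
    using assms(1)[OF j] lin_scale[OF assms(2)] by metis
  then show "rd j (f v) = sv (a j + of_int (zadd s m j)) (f v)"
    by (simp add: zadd_def V.scale_left_distrib[symmetric] add.assoc)
qed

text \<open>Every generator shifts the weight of the \<open>rd j\<close> by integers, so this span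
  is a submodule; it contains \<open>v0\<close>. Thus all degrees in \<open>V\<close> lie in one
  coset of Z^n.\<close>

lemma span_grade:
  assumes "v0 \<in> wt lam c a" "v0 \<noteq> 0"
  shows "v \<in> V.span (\<Union>s\<in>Collect (zvec n). grade a s)"
proof -
  let ?U = "\<Union>s\<in>Collect (zvec n). grade a s"
  have base: "f x \<in> V.span ?U" if "x \<in> grade a s" "lin f" "zvec n s" "zvec n m"
    "\<And>i v. i < n \<Longrightarrow> rd i (f v) = f (rd i v) + sv (of_int (m i)) (f v)" for f x s m
  proof (rule V.span_base)
    have "zvec n (zadd s m)" using that by (simp add: zvec_def zadd_def)
    then show "f x \<in> ?U" using grade_shift[OF that(5,2,1)] by blast
  qed
  have "V.span ?U = {0} \<or> V.span ?U = UNIV"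
  proof (rule submodule_trivial)
    show "V.subspace (V.span ?U)" by (rule V.subspace_span)
    have into: "f v \<in> V.span ?U" if "v \<in> V.span ?U" "lin f" "zvec n m"
      "\<And>i v. i < n \<Longrightarrow> rd i (f v) = f (rd i v) + sv (of_int (m i)) (f v)" for f v m
      using that(2) _ that(1)
    proof (rule lin_span_into)
      fix x assume "x \<in> ?U"
      then obtain s where "zvec n s" "x \<in> grade a s" by blast
      then show "f x \<in> V.span ?U" using base that by blast
    qed
    show "rg X r v \<in> V.span ?U" if "zvec n r" "v \<in> V.span ?U" for X r v
    proof (rule into[OF that(2) lin_rg that(1)])
      show "rd i (rg X r v) = rg X r (rd i v) + sv (of_int (r i)) (rg X r v)" if "i < n" for i v
        using rd_rg[OF that \<open>zvec n r\<close>, of X v] by (simp add: diff_eq_eq add.commute)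
    qed fact
    show "rK m i v \<in> V.span ?U" if "zvec n m" "i < n" "v \<in> V.span ?U" for m i v
      by (rule into[OF that(3) lin_rK[OF that(1,2)] that(1) centralD(4)[OF central_rK[OF that(1,2)]]])
    show "rd i v \<in> V.span ?U" if "i < n" "v \<in> V.span ?U" for i v
      by (rule into[OF that(2) lin_rd[OF that(1)] zvec_zzero]) (simp add: zzero_def rd_rd that(1))
  qed
  moreover have "v0 \<in> V.span ?U"
  proof (rule V.span_base)
    have "v0 \<in> grade a zzero" using assms unfolding wt_def grade_def by (simp add: zzero_def)
    then show "v0 \<in> ?U" using zvec_zzero by blast
  qed
  ultimately show ?thesis using assms by auto
qed

lemma grade_independent:
  assumes "finite F" "F \<subseteq> Collect (zvec n)" "\<And>s. s \<in> F \<Longrightarrow> f s \<in> grade a s" "sum f F = 0" "s \<in> F"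
  shows "f s = 0"
proof (rule V.weight_vectors_independent[where I = "{..<n}" and T = rd and S = "Collect (zvec n)"
      and E = "grade a" and \<tau> = "\<lambda>i s. a i + of_int (s i)" and F = F and f = f])
  fix s t :: "nat \<Rightarrow> int" assume "s \<in> Collect (zvec n)" "t \<in> Collect (zvec n)" "s \<noteq> t"
  then obtain i where i: "s i \<noteq> t i" "zvec n s" "zvec n t" by auto
  moreover have "i < n" using i unfolding zvec_def by (metis not_le)
  ultimately show "\<exists>i\<in>{..<n}. a i + of_int (s i) \<noteq> a i + (of_int (t i) :: complex)" by auto
qed (use assms in \<open>auto simp: lin_rd subspace_grade\<close>, auto simp: grade_def)

lemma lin_funpow: "lin f \<Longrightarrow> lin (f ^^ i)"
proof (induction i)
  case (Suc i)
  then show ?case using lin_compose[of f "f ^^ i"] by (simp add: comp_def)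
qed (simp add: V.linear_selfI)

lemma lin_bij_pow: "central l z \<Longrightarrow> bij z \<Longrightarrow> lin (bij_pow z q)"
  unfolding bij_pow_def using lin_funpow centralD(1) central_inv by (metis (full_types))

lemma lin_shift_op:
  assumes "\<And>i. i < k \<Longrightarrow> central (l i) (z i) \<and> bij (z i)"
  shows "lin (shift_op z q k)"
  using assms
proof (induction k)
  case (Suc k)
  then have "lin (\<lambda>v. bij_pow (z k) (- q k) (shift_op z q k v))"
    using lin_compose lin_bij_pow by (meson less_Suc_eq)
  then show ?case by simp
qed (simp add: V.linear_selfI)

lemma central_grade: "central l z \<Longrightarrow> v \<in> grade a s \<Longrightarrow> z v \<in> grade a (\<lambda>j. s j + l j)"
  using grade_shift[of z l v a s] centralD(1,4) unfolding zadd_def by blast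

lemma funpow_grade: "central l z \<Longrightarrow> v \<in> grade a s \<Longrightarrow> (z ^^ i) v \<in> grade a (\<lambda>j. s j + int i * l j)"
proof (induction i)
  case (Suc i)
  then have "z ((z ^^ i) v) \<in> grade a (\<lambda>j. (s j + int i * l j) + l j)"
    using central_grade[of l z "(z ^^ i) v" a "\<lambda>j. s j + int i * l j"] by simp
  then show ?case by (simp add: algebra_simps)
qed simp

lemma bij_pow_grade:
  assumes "central l z" "bij z" "v \<in> grade a s"
  shows "bij_pow z q v \<in> grade a (\<lambda>j. s j + q * l j)"
  using funpow_grade[OF assms(1,3), of "nat q"] funpow_grade[OF central_inv[OF assms(1,2)] assms(3), of "nat (- q)"]
  by (auto simp: bij_pow_def)

lemma lin_comb: "(\<And>l. l < n \<Longrightarrow> lin (f l)) \<Longrightarrow> lin (\<lambda>v. \<Sum>l<n. sv (c l) (f l v))"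
  by (intro V.linear_selfI)
    (simp_all add: lin_add lin_scale V.scale_right_distrib sum.distrib V.scale_sum_right mult.commute)

text \<open>A degree-preserving \<open>f\<close> acts on each component separately, so the
  eigenvalue equation can be compared degree by degree.\<close>

lemma component_eigenvector:
  assumes lin: "lin f" and pres: "\<And>s v. zvec n s \<Longrightarrow> v \<in> grade a s \<Longrightarrow> f v \<in> grade a s"
    and F: "finite F" "F \<subseteq> Collect (zvec n)" "\<And>s. s \<in> F \<Longrightarrow> g s \<in> grade a s"
    and eig: "f (sum g F) = sv c (sum g F)" and s: "s \<in> F"
  shows "f (g s) = sv c (g s)"
proof -
  have "f (g s) - sv c (g s) = 0"
  proof (rule grade_independent[OF F(1,2) _ _ s, where f = "\<lambda>s. f (g s) - sv c (g s)"])
    show "f (g s) - sv c (g s) \<in> grade a s" if "s \<in> F" for s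
      using that F pres by (intro V.subspace_diff[OF subspace_grade] V.subspace_scale[OF subspace_grade]) auto
    show "(\<Sum>s\<in>F. f (g s) - sv c (g s)) = 0"
      using eig by (simp add: sum_subtractf lin_sum[OF lin] V.scale_sum_right)
  qed
  then show ?thesis by simp
qed

section \<open>The twisted action and its quotient\<close>

lemma matvec_zzero [simp]: "matvec n B zzero = zzero"
  by (auto simp: matvec_def zzero_def)

lemma tw_d_central:
  assumes "central d z"
  shows "tw_d n B sv rd j (z v) =
    z (tw_d n B sv rd j v) + sv (of_int (\<Sum>l<n. mat_inv_int n B j l * d l)) (z v)"
proof -
  note zD = centralD[OF assms]
  let ?C = "mat_inv_int n B"
  have "tw_d n B sv rd j (z v) = (\<Sum>l<n. sv (of_int (?C j l)) (z (rd l v)) + sv (of_int (?C j l * d l)) (z v))"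
    unfolding tw_d_def by (intro sum.cong refl) (simp add: zD(4) V.scale_right_distrib)
  also have "\<dots> = (\<Sum>l<n. sv (of_int (?C j l)) (z (rd l v))) + sv (of_int (\<Sum>l<n. ?C j l * d l)) (z v)"
    unfolding sum.distrib of_int_sum V.scale_sum_left ..
  finally show ?thesis
    unfolding tw_d_def by (simp add: lin_sum[OF zD(1)] lin_scale[OF zD(1)])
qed

lemma central_op_twist:
  assumes "central d z"
  shows "central_op n sv (tw_g n B rg) (tw_K n B sv rK) (tw_d n B sv rd) (matvec n (mat_inv_int n B) d) z"
  unfolding central_op_def lin_op_def
proof (intro conjI allI impI)
  note zD = centralD[OF assms]
  show "lin z" by (rule zD(1))
  show "z (tw_g n B rg X r v) = tw_g n B rg X r (z v)" for X r v
    by (simp add: tw_g_def zD(2))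
  show "z (tw_K n B sv rK s j v) = tw_K n B sv rK s j (z v)" for s j v
    by (simp add: tw_K_def lin_sum[OF zD(1)] lin_scale[OF zD(1)] zD(3))
  show "tw_d n B sv rd i (z v) - z (tw_d n B sv rd i v) =
      sv (of_int (matvec n (mat_inv_int n B) d i)) (z v)" if "i < n" for i v
    using that by (simp add: tw_d_central[OF assms] matvec_def)
qed

text \<open>In the quotient, degrees that differ by a multiple of \<open>deg z_i\<close> are
  identified. The first \<open>k\<close> coordinates then matter only modulo \<open>m i\<close>, so
  a weight for the remaining directions meets finitely many of the original weight spaces.\<close>

lemma graded_quotient:
  assumes B: "GL_int n B" and k: "k \<le> n"
    and m: "\<And>i. i < k \<Longrightarrow> 0 < m i"
    and z: "\<And>i. i < k \<Longrightarrow> bicentral (\<lambda>a. m i * int_col n B i a) (z i)"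
  defines "rg' \<equiv> tw_g n B rg" and "rK' \<equiv> tw_K n B sv rK" and "rd' \<equiv> tw_d n B sv rd"
  shows "\<exists>W. module.subspace sv W \<and> W \<noteq> UNIV \<and>
          (\<forall>X r. zvec n r \<longrightarrow> rg' X r ` W \<subseteq> W) \<and>
          (\<forall>m i. zvec n m \<longrightarrow> i < n \<longrightarrow> rK' m i ` W \<subseteq> W) \<and>
          (\<forall>j. k \<le> j \<and> j < n \<longrightarrow> rd' j ` W \<subseteq> W) \<and>
          fd_weight_quot n sv W h {k..<n} rg' rK' rd'"
proof -
  define C where "C = mat_inv_int n B"
  have BC: "inverse_int_mat n B C" unfolding C_def using inverse_mat_inv_int[OF B] .
  have BCs: "(\<Sum>l<n. B i l * C l j) = (if i = j then 1 else 0)" if "i < n" "j < n" for i j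
    using BC that unfolding inverse_int_mat_def by blast
  define deg where "deg i = (\<lambda>a. m i * int_col n B i a)" for i
  \<comment> \<open>\<open>co s\<close> is the degree as measured by the twisted derivations;
    \<open>z i\<close> moves it by \<open>m i\<close> in direction \<open>i\<close> only.\<close>
  define co where "co s = matvec n C s" for s
  have zc: "central (deg i) (z i)" "bij (z i)" if "i < k" for i
    using z[OF that] unfolding bicentral_def deg_def by auto
  have zcomm: "z i (f v) = f (z i v)" if "i < k" "central l f" for i f l v
    using z[OF that(1)] that(2) unfolding bicentral_def by blast
  have zz: "z i (z j v) = z j (z i v)" if "i < k" "j < k" for i j v
    using zcomm[OF that(1) zc(1)[OF that(2)]] .
  have codeg: "(\<Sum>l<n. C j l * deg i l) = (if j = i then m i else 0)" if "i < k" "j < n" for i j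
    unfolding C_def deg_def using mat_inv_int_col[OF B] that k by simp
  have co_shift: "co (\<lambda>j. s j + q * deg i j) j = co s j + (if j = i then q * m i else 0)"
    if "i < k" "j < n" for s q i j
  proof -
    have "co (\<lambda>j. s j + q * deg i j) j = co s j + q * (\<Sum>l<n. C j l * deg i l)"
      using that by (simp add: co_def matvec_def algebra_simps sum.distrib sum_distrib_left)
    then show ?thesis by (simp add: codeg[OF that])
  qed
  have zdeg: "zvec n (\<lambda>j. s j + q * deg i j)" if "zvec n s" for s q i
    using that by (simp add: zvec_def deg_def int_col_def)
  obtain lam0 c0 a0 v0 where v0: "v0 \<in> wt lam0 c0 a0" "v0 \<noteq> 0" by (rule nonzero_weight_vector)
  define E where "E = grade a0"
  define U where "U = (\<Union>s\<in>Collect (zvec n). E s)"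
  have span: "v \<in> V.span U" for v using span_grade[OF v0] unfolding U_def E_def .
  \<comment> \<open>\<open>\<Phi>\<close> normalizes every degree, in the coordinates \<open>co\<close>, to the box \<open>0 \<le> co s i < m i\<close>. Taking \<open>W\<close> to be its
    kernel, rather than the span of the images of \<open>z i - 1\<close>, makes properness immediate.\<close>
  define q where "q s i = co s i div m i" for s i
  define N where "N s = shift_op z (q s) k" for s
  have linN: "lin (N s)" for s unfolding N_def using zc by (intro lin_shift_op) blast
  obtain \<Phi> where \<Phi>: "lin \<Phi>" "\<And>s v. zvec n s \<Longrightarrow> v \<in> E s \<Longrightarrow> \<Phi> v = N s v"
  proof (rule V.graded_linear_extension[of "Collect (zvec n)" E N])
    show "V.subspace (E s)" for s unfolding E_def by (rule subspace_grade)
    show "v \<in> V.span (\<Union>s\<in>Collect (zvec n). E s)" for v using span unfolding U_def .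
    show "f s = 0" if "finite F" "F \<subseteq> Collect (zvec n)" "\<And>s. s \<in> F \<Longrightarrow> f s \<in> E s" "sum f F = 0" "s \<in> F" for F f s
      using that unfolding E_def by (rule grade_independent)
  qed (auto simp: linN)
  have ext: "f v = f' v" if "lin f" "lin f'" "\<And>s x. zvec n s \<Longrightarrow> x \<in> E s \<Longrightarrow> f x = f' x" for f f' v
    by (rule lin_eq_on_span[OF that(1,2) _ span]) (use that(3) in \<open>auto simp: U_def\<close>)
  have zlin: "lin (z i)" if "i < k" for i using centralD(1)[OF zc(1)[OF that]] .
  have \<Phi>z: "\<Phi> (z i v) = \<Phi> v" if i: "i < k" for i v
  proof (rule ext[where f = "\<lambda>v. \<Phi> (z i v)"])
    fix s x assume s: "zvec n s" "x \<in> E s"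
    have zx: "z i x \<in> E (\<lambda>j. s j + 1 * deg i j)"
      using central_grade[OF zc(1)[OF i]] s(2) unfolding E_def by simp
    \<comment> \<open>Moving coordinate \<open>i\<close> by exactly \<open>m i\<close> raises the
      quotient \<open>q\<close> by one there and leaves the others, which cancels the extra
      \<open>z i\<close>.\<close>
    have "q (\<lambda>j. s j + 1 * deg i j) i = q s i + 1"
      unfolding q_def using co_shift[OF i, of i s 1] m[OF i] i k by simp
    moreover have "q (\<lambda>j. s j + 1 * deg i j) j = q s j" if "j < k" "j \<noteq> i" for j
      unfolding q_def using co_shift[OF i, of j s 1] that k by simp
    ultimately have "N (\<lambda>j. s j + 1 * deg i j) (z i x) = N s x"
      unfolding N_def using zc zz i by (intro shift_op_increment) auto
    then show "\<Phi> (z i x) = \<Phi> x" using \<Phi>(2)[OF zdeg[OF s(1)] zx] \<Phi>(2)[OF s] by simp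
  qed (use lin_compose \<Phi>(1) zlin[OF i] in auto)
  have \<Phi>zinv: "\<Phi> (inv (z i) v) = \<Phi> v" if "i < k" for i v
    using \<Phi>z[OF that, of "inv (z i) v"] zc(2)[OF that] by (simp add: bij_is_surj surj_f_inv_f)
  have \<Phi>shift: "\<Phi> (shift_op z p l v) = \<Phi> v" if "l \<le> k" for p l v
    using that
  proof (induction l)
    case (Suc l)
    have "\<Phi> (bij_pow (z l) (- p l) (shift_op z p l v)) = \<Phi> (shift_op z p l v)"
      by (rule bij_pow_induct[where P = "\<lambda>w. \<Phi> w = \<Phi> (shift_op z p l v)"])
        (use Suc.prems zc \<Phi>z \<Phi>zinv in auto)
    then show ?case using Suc by simp
  qed simp
  have \<Phi>\<Phi>: "\<Phi> (\<Phi> v) = \<Phi> v" for v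
    by (rule ext[where f = "\<lambda>v. \<Phi> (\<Phi> v)"])
      (use lin_compose \<Phi> \<Phi>shift[of k] in \<open>auto simp: N_def\<close>)
  \<comment> \<open>An operator that changes degrees also changes the normalizing exponents, so
    equality holds only after a further \<open>\<Phi>\<close>; this gives stability of
    \<open>W\<close>. Degree-preserving operators commute with \<open>\<Phi>\<close> itself, as
    shown next.\<close>
  have \<Phi>f: "\<Phi> (f (\<Phi> v)) = \<Phi> (f v)" if "lin f" "\<And>i v. i < k \<Longrightarrow> f (z i v) = z i (f v)" for f v
  proof (rule ext[where f = "\<lambda>v. \<Phi> (f (\<Phi> v))"])
    fix s x assume s: "zvec n s" "x \<in> E s"
    have "f (N s x) = N s (f x)" unfolding N_def using zc that(2) by (intro shift_op_commute) auto
    then show "\<Phi> (f (\<Phi> x)) = \<Phi> (f x)" unfolding \<Phi>(2)[OF s] N_def by (simp add: \<Phi>shift)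
  qed (use \<Phi>(1) that(1) lin_compose in auto)
  have \<Phi>comm: "\<Phi> (f v) = f (\<Phi> v)" if "lin f" "\<And>i v. i < k \<Longrightarrow> f (z i v) = z i (f v)"
    "\<And>s v. zvec n s \<Longrightarrow> v \<in> E s \<Longrightarrow> f v \<in> E s" for f v
  proof (rule ext[where f = "\<lambda>v. \<Phi> (f v)"])
    fix s x assume s: "zvec n s" "x \<in> E s"
    have "f (N s x) = N s (f x)" unfolding N_def using zc that(2) by (intro shift_op_commute) auto
    then show "\<Phi> (f x) = f (\<Phi> x)" using \<Phi>(2)[OF s] \<Phi>(2)[OF s(1) that(3)[OF s]] by simp
  qed (use \<Phi>(1) that(1) lin_compose in auto)
  define W where "W = {v. \<Phi> v = 0}"
  have Wsub: "V.subspace W"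
    unfolding W_def V.subspace_def by (simp add: lin_zero[OF \<Phi>(1)] lin_add[OF \<Phi>(1)] lin_scale[OF \<Phi>(1)])
  have Wstable: "f ` W \<subseteq> W" if "lin f" "\<And>i v. i < k \<Longrightarrow> f (z i v) = z i (f v)" for f
  proof
    fix w assume "w \<in> f ` W"
    then obtain v where v: "w = f v" "\<Phi> v = 0" unfolding W_def by blast
    then show "w \<in> W" using \<Phi>f[OF that, of v] by (simp add: W_def lin_zero[OF that(1)] lin_zero[OF \<Phi>(1)])
  qed
  \<comment> \<open>A vector of shift zero is already normalized, so \<open>\<Phi>\<close> fixes
    \<open>v0\<close> and \<open>W\<close> is proper.\<close>
  have "v0 \<in> E zzero" using v0 unfolding E_def wt_def grade_def by (simp add: zzero_def)
  then have "\<Phi> v0 = N zzero v0" by (intro \<Phi>(2)) simp_all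
  also have "\<dots> = v0" unfolding N_def by (rule shift_op_zero) (simp add: q_def co_def, simp add: zzero_def)
  finally have "v0 \<notin> W" using v0(2) unfolding W_def by simp
  then have Wproper: "W \<noteq> UNIV" by blast

  have rg'_lin: "lin (rg' X r)" for X r unfolding rg'_def tw_g_def by (intro lin_rg zvec_matvec)
  have rg'_z: "rg' X r (z i v) = z i (rg' X r v)" if "i < k" for X r i v
    unfolding rg'_def tw_g_def using centralD(2)[OF zc(1)[OF that]] by simp
  have rK'_central: "central (matvec n B r) (rK' r j)" for r j
    unfolding rK'_def tw_K_def by (intro central_K_combination zvec_matvec)
  have rd'_lin: "lin (rd' j)" for j
    unfolding rd'_def tw_d_def by (intro lin_comb lin_rd)
  \<comment> \<open>For \<open>i < k \<le> j\<close> the degree of \<open>z i\<close> has no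
    component in direction \<open>j\<close>, so the commutator vanishes.\<close>
  have rd'_z: "rd' j (z i v) = z i (rd' j v)" if "i < k" "k \<le> j" "j < n" for i j v
    unfolding rd'_def tw_d_central[OF zc(1)[OF that(1)]]
    using codeg[OF that(1,3)] that by (simp add: C_def)
  define \<alpha> where "\<alpha> j = (\<Sum>l<n. of_int (C j l) * a0 l)" for j
  have rd'_E: "rd' j v = sv (\<alpha> j + of_int (co s j)) v" if "j < n" "v \<in> E s" for j v s
  proof -
    have "rd' j v = (\<Sum>l<n. sv (of_int (C j l) * (a0 l + of_int (s l))) v)"
      unfolding rd'_def tw_d_def C_def[symmetric] using that(2)
      by (intro sum.cong refl) (simp add: E_def grade_def)
    also have "\<dots> = sv (\<Sum>l<n. of_int (C j l) * (a0 l + of_int (s l))) v"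
      by (simp add: V.scale_sum_left)
    also have "(\<Sum>l<n. of_int (C j l) * (a0 l + of_int (s l))) = \<alpha> j + of_int (co s j)"
      using that(1) by (simp add: \<alpha>_def co_def matvec_def distrib_left sum.distrib)
    finally show ?thesis .
  qed
  have E_scale: "sv c v \<in> E s" if "v \<in> E s" for c v s
    using that unfolding E_def by (rule V.subspace_scale[OF subspace_grade])
  have rg_E: "rg x zzero v \<in> E s" if "v \<in> E s" for x v s
  proof -
    have "rg x zzero v \<in> grade a0 (zadd s zzero)"
    proof (rule grade_shift[where f = "rg x zzero"])
      show "rd i (rg x zzero v) = rg x zzero (rd i v) + sv (of_int (zzero i)) (rg x zzero v)" if "i < n" for i v
        using rd_rg[OF that zvec_zzero, of x v] by (simp add: diff_eq_eq add.commute)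
    qed (use that in \<open>auto simp: lin_rg E_def\<close>)
    then show ?thesis by (simp add: E_def zadd_def zzero_def)
  qed
  have central0_E: "f v \<in> E s" if "central zzero f" "v \<in> E s" for f v s
    using central_grade[OF that(1)] that(2) unfolding E_def by (simp add: zzero_def)

  define box where "box = {s. zvec n s \<and> (\<forall>i<k. 0 \<le> co s i \<and> co s i < m i)}"
  \<comment> \<open>Each factor of the shift subtracts \<open>p j * m j\<close> from coordinate
    \<open>j\<close>; with \<open>p\<close> the integer quotients this leaves remainders modulo
    \<open>m j\<close>.\<close>
  have shift_E: "\<exists>s'. zvec n s' \<and> shift_op z p l v \<in> E s' \<and>
      (\<forall>j<n. co s' j = co s j - (if j < l then p j * m j else 0))" if "zvec n s" "v \<in> E s" "l \<le> k" for p l v s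
    using that(3)
  proof (induction l)
    case 0
    then show ?case using that by auto
  next
    case (Suc l)
    then obtain s' where s': "zvec n s'" "shift_op z p l v \<in> E s'"
      "\<forall>j<n. co s' j = co s j - (if j < l then p j * m j else 0)" by auto
    let ?s = "\<lambda>j. s' j + (- p l) * deg l j"
    have "shift_op z p (Suc l) v \<in> E ?s"
      using bij_pow_grade[of "deg l" "z l" "shift_op z p l v" a0 s' "- p l"] zc[of l] s'(2) Suc.prems
      unfolding E_def by simp
    moreover have "\<forall>j<n. co ?s j = co s j - (if j < Suc l then p j * m j else 0)"
      using s'(3) co_shift[of l _ s' "- p l"] Suc.prems by (auto simp: less_Suc_eq)
    ultimately show ?case using zdeg[OF s'(1)] by blast
  qed
  have \<Phi>_box: "\<Phi> v \<in> V.span (\<Union>s\<in>box. E s)" for v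
  proof (rule lin_span_into[OF \<Phi>(1) _ span])
    fix x assume "x \<in> U"
    then obtain s where s: "zvec n s" "x \<in> E s" unfolding U_def by blast
    obtain s' where s': "zvec n s'" "N s x \<in> E s'" "\<forall>j<n. co s' j = co s j - (if j < k then q s j * m j else 0)"
      using shift_E[OF s order_refl, of "q s"] unfolding N_def by blast
    have "0 \<le> co s' i \<and> co s' i < m i" if "i < k" for i
    proof -
      have "co s' i = co s i mod m i"
        using s'(3) that k by (simp add: q_def minus_div_mult_eq_mod)
      then show ?thesis using m[OF that] by simp
    qed
    then have "s' \<in> box" using s'(1) unfolding box_def by blast
    then show "\<Phi> x \<in> V.span (\<Union>s\<in>box. E s)" unfolding \<Phi>(2)[OF s] using s'(2) by (intro V.span_base) blast
  qed

  have "\<exists>F. finite F \<and> wt_space_mod n sv W h {k..<n} rg' rK' rd' lam c a \<subseteq> V.span (F \<union> W)" for lam c a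
  proof -
    \<comment> \<open>Coordinates below \<open>k\<close> range over the box and the others are
      forced by the weight \<open>a\<close>, so only finitely many degrees can contribute.\<close>
    define fin where "fin = {s \<in> box. \<forall>j. k \<le> j \<and> j < n \<longrightarrow> \<alpha> j + of_int (co s j) = a j}"
    have "finite fin"
    proof (rule finite_imageD)
      let ?r = "\<lambda>s i. if i < k then co s i else 0"
      show "finite (?r ` fin)"
      proof (rule finite_subset)
        show "?r ` fin \<subseteq> {f. \<forall>i. (i \<in> {..<k} \<longrightarrow> f i \<in> (\<Union>i<k. {0..<m i})) \<and> (i \<notin> {..<k} \<longrightarrow> f i = 0)}"
          unfolding fin_def box_def by (auto intro!: bexI)
        show "finite {f. \<forall>i. (i \<in> {..<k} \<longrightarrow> f i \<in> (\<Union>i<k. {0..<m i})) \<and> (i \<notin> {..<k} \<longrightarrow> f i = 0)}"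
          by (rule finite_set_of_finite_funs) auto
      qed
      show "inj_on ?r fin"
      proof (rule inj_onI)
        fix s s' assume s: "s \<in> fin" "s' \<in> fin" "?r s = ?r s'"
        have "co s = co s'"
        proof
          fix j
          consider "j < k" | "k \<le> j" "j < n" | "n \<le> j" by linarith
          then show "co s j = co s' j"
          proof cases
            case 1
            then show ?thesis using fun_cong[OF s(3), of j] by simp
          next
            case 2
            then have "\<alpha> j + of_int (co s j) = \<alpha> j + of_int (co s' j)" using s(1,2) unfolding fin_def by simp
            then show ?thesis by simp
          next
            case 3
            then show ?thesis by (simp add: co_def matvec_def)
          qed
        qed
        then have "matvec n B (co s) = matvec n B (co s')" by simp
        then show "s = s'"
          using s(1,2) matvec_inverse[OF BC] unfolding co_def fin_def box_def by simp
      qed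
    qed
    \<comment> \<open>The twisted \<open>K_j\<close> are combinations of the \<open>K_l\<close> with
      the columns of \<open>B\<close>; the inverse matrix recovers the eigenvalues of the original
      \<open>K_l\<close>.\<close>
    define c' where "c' l = (\<Sum>j<n. of_int (C j l) * c j)" for l
    have "\<forall>s. \<exists>F. finite F \<and> wt lam c' (\<lambda>j. a0 j + of_int (s j)) \<subseteq> V.span F" using wt_finite_dim by blast
    then obtain F where F: "\<And>s. finite (F s)" "\<And>s. wt lam c' (\<lambda>j. a0 j + of_int (s j)) \<subseteq> V.span (F s)"
      by metis
    have "v \<in> V.span ((\<Union>s\<in>fin. F s) \<union> W)" if v: "v \<in> wt_space_mod n sv W h {k..<n} rg' rK' rd' lam c a" for v
    proof -
      define w where "w = \<Phi> v"
      \<comment> \<open>Passing to the representative \<open>\<Phi> v\<close> turns an eigenvalue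
        equation modulo \<open>W\<close> into a genuine one.\<close>
      have eig: "f w = sv c w" if "f v - sv c v \<in> W" "lin f" "\<And>i v. i < k \<Longrightarrow> f (z i v) = z i (f v)"
        "\<And>s v. zvec n s \<Longrightarrow> v \<in> E s \<Longrightarrow> f v \<in> E s" for f c
      proof -
        have "\<Phi> (f v) = sv c (\<Phi> v)"
          using that(1) unfolding W_def by (simp add: lin_diff[OF \<Phi>(1)] lin_scale[OF \<Phi>(1)])
        moreover have "\<Phi> (f v) = f (\<Phi> v)" using that(2-4) by (rule \<Phi>comm)
        ultimately show ?thesis unfolding w_def by simp
      qed
      have w_h: "rg x zzero w = sv (lam x) w" if "x \<in> h" for x
      proof (rule eig[where f = "rg x zzero"])
        show "rg x zzero v - sv (lam x) v \<in> W"
          using v that unfolding wt_space_mod_def rg'_def tw_g_def by simp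
      qed (use centralD(2)[OF zc(1)] rg_E in \<open>auto simp: lin_rg\<close>)
      have rK'0: "central zzero (rK' zzero i)" for i using rK'_central[of zzero i] by simp
      have w_K': "rK' zzero i w = sv (c i) w" if "i < n" for i
      proof (rule eig[where f = "rK' zzero i"])
        show "rK' zzero i v - sv (c i) v \<in> W"
          using v that unfolding wt_space_mod_def by simp
      qed (use centralD(1)[OF rK'0] zcomm[OF _ rK'0] central0_E[OF rK'0] in auto)
      have w_K: "rK zzero l w = sv (c' l) w" if "l < n" for l
      proof -
        have "sv (c' l) w = (\<Sum>j<n. sv (of_int (C j l)) (rK' zzero j w))"
          unfolding c'_def V.scale_sum_left by (intro sum.cong refl) (simp add: w_K')
        also have "\<dots> = (\<Sum>j<n. \<Sum>i<n. sv (of_int (B i j * C j l)) (rK zzero i w))"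
          unfolding rK'_def tw_K_def V.scale_sum_right by (simp add: mult.commute)
        also have "\<dots> = (\<Sum>i<n. sv (of_int (\<Sum>j<n. B i j * C j l)) (rK zzero i w))"
          by (subst sum.swap) (simp add: V.scale_sum_left)
        also have "\<dots> = (\<Sum>i<n. if i = l then rK zzero i w else 0)"
          using that by (intro sum.cong refl) (simp add: BCs)
        finally show ?thesis using that by simp
      qed
      have w_d: "rd' j w = sv (a j) w" if "k \<le> j" "j < n" for j
      proof (rule eig[where f = "rd' j"])
        show "rd' j v - sv (a j) v \<in> W"
          using v that unfolding wt_space_mod_def by simp
        show "rd' j v \<in> E s" if "v \<in> E s" for v s
          unfolding rd'_E[OF \<open>j < n\<close> that] by (rule E_scale[OF that])
      qed (use that rd'_z rd'_lin in auto)
      \<comment> \<open>The homogeneous components of \<open>w\<close> have known weights for all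
        the original \<open>rd j\<close>, including those below \<open>k\<close>. Each nonzero one
        therefore lies in an original, finite-dimensional weight space with degree in
        \<open>fin\<close>.\<close>
      obtain S g where S: "finite S" "S \<subseteq> box" "\<And>s. s \<in> box \<Longrightarrow> g s \<in> E s" "w = sum g S"
        using V.span_Union_decomposition[of box E w] \<Phi>_box[of v] subspace_grade unfolding w_def E_def by metis
      have comp: "f (g s) = sv c (g s)" if "lin f" "\<And>s v. zvec n s \<Longrightarrow> v \<in> E s \<Longrightarrow> f v \<in> E s"
        "f w = sv c w" "s \<in> S" for f c s
      proof (rule component_eigenvector[where a = a0 and F = S and f = f and g = g])
        show "S \<subseteq> Collect (zvec n)" using S(2) unfolding box_def by blast
      qed (use that S in \<open>auto simp: E_def\<close>)
      have gs: "g s \<in> V.span ((\<Union>s\<in>fin. F s) \<union> W)" if "s \<in> S" for s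
      proof (cases "g s = 0")
        case True
        then show ?thesis by (simp add: V.span_zero)
      next
        case False
        have sE: "g s \<in> E s" using S(2,3) that by blast
        have "\<alpha> j + of_int (co s j) = a j" if j: "k \<le> j" "j < n" for j
        proof -
          have "rd' j (g s) = sv (a j) (g s)"
            using comp[OF rd'_lin _ w_d[OF j] \<open>s \<in> S\<close>] rd'_E[OF j(2)] E_scale by metis
          then have "sv (\<alpha> j + of_int (co s j)) (g s) = sv (a j) (g s)" using rd'_E[OF j(2) sE] by simp
          then show ?thesis using False by (simp only: V.scale_cancel_right) simp
        qed
        then have "s \<in> fin" using S(2) that unfolding fin_def by blast
        have "rg x zzero (g s) = sv (lam x) (g s)" if "x \<in> h" for x
          using comp[OF lin_rg _ w_h[OF that] \<open>s \<in> S\<close>] rg_E by simp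
        moreover have "rK zzero l (g s) = sv (c' l) (g s)" if "l < n" for l
          using comp[OF lin_rK[OF zvec_zzero that] _ w_K[OF that] \<open>s \<in> S\<close>]
            central0_E[OF central_rK[OF zvec_zzero that]] by simp
        moreover have "rd j (g s) = sv (a0 j + of_int (s j)) (g s)" if "j < n" for j
          using sE that unfolding E_def grade_def by blast
        ultimately have "g s \<in> wt lam c' (\<lambda>j. a0 j + of_int (s j))" unfolding wt_def by blast
        then have "g s \<in> V.span (F s)" using F(2) by blast
        moreover have "F s \<subseteq> (\<Union>s\<in>fin. F s) \<union> W" using \<open>s \<in> fin\<close> by blast
        ultimately show ?thesis using V.span_mono by blast
      qed
      have "w \<in> V.span ((\<Union>s\<in>fin. F s) \<union> W)" unfolding S(4) using gs by (rule V.span_sum)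
      moreover have "v - w \<in> W" by (simp add: W_def w_def lin_diff[OF \<Phi>(1)] \<Phi>\<Phi>)
      then have "v - w \<in> V.span ((\<Union>s\<in>fin. F s) \<union> W)" by (intro V.span_base) blast
      ultimately have "w + (v - w) \<in> V.span ((\<Union>s\<in>fin. F s) \<union> W)" by (rule V.span_add)
      then show ?thesis by simp
    qed
    then show ?thesis using \<open>finite fin\<close> F(1) by (intro exI[of _ "\<Union>s\<in>fin. F s"]) auto
  qed
  moreover have "UNIV \<subseteq> V.span (W \<union> (\<Union>lam c a. wt_space_mod n sv W h {k..<n} rg' rK' rd' lam c a))"
  proof
    fix v :: 'v
    \<comment> \<open>Original weight vectors are weight vectors for the twisted action too, with
      linearly transformed weights.\<close>
    have sub: "wt lam c a \<subseteq> wt_space_mod n sv W h {k..<n} rg' rK' rd' lam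
        (\<lambda>i. \<Sum>l<n. of_int (B l i) * c l) (\<lambda>j. \<Sum>l<n. of_int (C j l) * a l)" for lam c a
      using V.subspace_0[OF Wsub] unfolding wt_def wt_space_mod_def
      by (auto simp: rg'_def tw_g_def rK'_def tw_K_def rd'_def tw_d_def C_def[symmetric] V.scale_sum_left)
    have "(\<Union>lam c a. wt lam c a) \<subseteq> W \<union> (\<Union>lam c a. wt_space_mod n sv W h {k..<n} rg' rK' rd' lam c a)"
    proof (intro subsetI, elim UN_E)
      fix u lam c a assume "u \<in> wt lam c a"
      from subsetD[OF sub this]
      show "u \<in> W \<union> (\<Union>lam c a. wt_space_mod n sv W h {k..<n} rg' rK' rd' lam c a)"
        by (intro UnI2 UN_I[OF UNIV_I])
    qed
    then show "v \<in> V.span (W \<union> (\<Union>lam c a. wt_space_mod n sv W h {k..<n} rg' rK' rd' lam c a))"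
      by (rule subsetD[OF V.span_mono span_wt])
  qed
  ultimately have "fd_weight_quot n sv W h {k..<n} rg' rK' rd'" unfolding fd_weight_quot_def by blast
  moreover have "rg' X r ` W \<subseteq> W" for X r by (rule Wstable[OF rg'_lin rg'_z])
  moreover have "rK' r j ` W \<subseteq> W" for r j
    by (rule Wstable[OF centralD(1)[OF rK'_central]]) (simp add: zcomm[OF _ rK'_central])
  moreover have "rd' j ` W \<subseteq> W" if "k \<le> j" "j < n" for j
    by (rule Wstable[OF rd'_lin rd'_z]) (use that in auto)
  ultimately show ?thesis using Wsub Wproper by blast
qed

end


section \<open>Choice of the twist and the five properties\<close>

theorem theorem4p5:
  fixes n :: nat
    and sg :: "complex \<Rightarrow> 'g::ab_group_add \<Rightarrow> 'g" and br :: "'g \<Rightarrow> 'g \<Rightarrow> 'g"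
    and form :: "'g \<Rightarrow> 'g \<Rightarrow> complex" and h :: "'g set"
    and sv :: "complex \<Rightarrow> 'v::ab_group_add \<Rightarrow> 'v"
    and rg :: "'g \<Rightarrow> (nat \<Rightarrow> int) \<Rightarrow> 'v \<Rightarrow> 'v"
    and rK :: "(nat \<Rightarrow> int) \<Rightarrow> nat \<Rightarrow> 'v \<Rightarrow> 'v"
    and rd :: "nat \<Rightarrow> 'v \<Rightarrow> 'v"
    and L :: "(nat \<Rightarrow> int) set" and k :: nat
  assumes n2: "n \<ge> 2"
    and simple: "simple_lie_algebra sg br"
    and cartan: "cartan_subalgebra sg br h"
    and form: "invariant_form sg br form"
    and module: "tau_module n sg br form sv rg rK rd"
    and irred: "tau_irreducible n sv rg rK rd"
    and fdwt: "fd_weight_quot n sv {0} h {..<n} rg rK rd"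
    and L_def: "L = {r. zvec n r \<and> (\<exists>i<n. \<exists>v. rK r i v \<noteq> 0)}
                    \<union> zneg ` {r. zvec n r \<and> (\<exists>i<n. \<exists>v. rK r i v \<noteq> 0)}"
    and k_def: "k = span_dim L"
  shows "\<exists>B. GL_int n B \<and>
    (let rg' = tw_g n B rg; rK' = tw_K n B sv rK; rd' = tw_d n B sv rd in
      (\<exists>m :: nat \<Rightarrow> int. \<exists>z :: nat \<Rightarrow> 'v \<Rightarrow> 'v. \<forall>i<k. m i \<noteq> 0 \<and> (\<exists>v. z i v \<noteq> 0) \<and>
          central_op n sv rg' rK' rd' (\<lambda>j. if j = i then m i else 0) (z i)) \<and>
      k < n \<and>
      (\<forall>i<n. \<forall>r. zvec n r \<longrightarrow> (\<exists>j. k \<le> j \<and> j < n \<and> r j \<noteq> 0) \<longrightarrow> (\<forall>v. rK' r i v = 0)) \<and>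
      (\<forall>i<k. \<forall>r. zvec n r \<longrightarrow> (\<forall>v. rK' r i v = 0)) \<and>
      (\<exists>W. module.subspace sv W \<and> W \<noteq> UNIV \<and>
          (\<forall>X r. zvec n r \<longrightarrow> rg' X r ` W \<subseteq> W) \<and>
          (\<forall>m i. zvec n m \<longrightarrow> i < n \<longrightarrow> rK' m i ` W \<subseteq> W) \<and>
          (\<forall>j. k \<le> j \<and> j < n \<longrightarrow> rd' j ` W \<subseteq> W) \<and>
          fd_weight_quot n sv W h {k..<n} rg' rK' rd'))"
proof -
  interpret irreducible_toroidal_module n sg br form h sv rg rK rd
    by unfold_locales fact+
  define supp where "supp = {r. zvec n r \<and> (\<exists>i<n. \<exists>v. rK r i v \<noteq> 0)}"
  have L: "L = supp \<union> zneg ` supp" unfolding L_def supp_def ..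
  have supp: "supp \<subseteq> central_degrees"
    unfolding supp_def central_degrees_def using bicentral_rK by blast
  have "zneg r \<in> central_degrees" if "r \<in> supp" for r
    using diff_central_degree[OF zzero_central_degree subsetD[OF supp that]]
    by (simp add: zneg_def zzero_def)
  with supp have L_central: "L \<subseteq> central_degrees" unfolding L by blast
  \<comment> \<open>All central degrees together may have rank larger than \<open>k\<close>.\<close>
  define H where "H = {r \<in> central_degrees. cvec r \<in> cfun.span (cvec ` L)}"
  have LH: "L \<subseteq> H" unfolding H_def using L_central by (auto intro: cfun.span_base)
  have "zzero \<in> H"
  proof -
    have "cvec zzero = 0" by (auto simp: cvec_def zzero_def)
    then show ?thesis unfolding H_def using zzero_central_degree by (simp add: cfun.span_zero)
  qed
  moreover have "(\<lambda>j. r j - s j) \<in> H" if "r \<in> H" "s \<in> H" for r s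
  proof -
    have "cvec (\<lambda>j. r j - s j) = cvec r - cvec s" by (auto simp: cvec_def)
    then show ?thesis using that unfolding H_def by (simp add: diff_central_degree cfun.span_diff)
  qed
  moreover have "zvec n r" if "r \<in> H" for r
    using that unfolding H_def central_degrees_def by blast
  ultimately obtain B l m where B: "GL_int n B" and "l \<le> n"
    and m: "\<forall>i<l. 0 < m i \<and> (\<lambda>a. m i * int_col n B i a) \<in> H"
    and coord: "\<forall>r\<in>H. \<exists>s. (\<forall>j\<ge>l. s j = 0) \<and> r = matvec n B s"
    using adapted_lattice_basis[of H n] by blast
  \<comment> \<open>Over the complex numbers the multiplier \<open>m i\<close> can be divided out;
    hence the number of adapted columns is exactly \<open>k\<close>.\<close>
  have col: "cvec (int_col n B i) \<in> cfun.span (cvec ` L)" if "i < l" for i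
  proof -
    have "cvec (\<lambda>a. m i * int_col n B i a) \<in> cfun.span (cvec ` L)"
      using m that unfolding H_def by blast
    then have "cscale (1 / of_int (m i)) (cvec (\<lambda>a. m i * int_col n B i a)) \<in> cfun.span (cvec ` L)"
      by (rule cfun.span_scale)
    moreover have "m i \<noteq> 0" using m that by fastforce
    then have "cscale (1 / of_int (m i)) (cvec (\<lambda>a. m i * int_col n B i a)) = cvec (int_col n B i)"
      by (auto simp: cscale_def cvec_def)
    ultimately show ?thesis by simp
  qed
  have "span_dim L = l"
    using coord LH by (intro span_dim_adapted_basis[OF B \<open>l \<le> n\<close> col]) auto
  then have kl: "l = k" by (simp add: k_def)
  have k: "k \<le> n" and m_pos: "\<And>i. i < k \<Longrightarrow> 0 < m i"
    and m_degree: "\<And>i. i < k \<Longrightarrow> (\<lambda>a. m i * int_col n B i a) \<in> central_degrees"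
    using \<open>l \<le> n\<close> m unfolding kl H_def by auto
  then obtain z where z: "\<And>i. i < k \<Longrightarrow> bicentral (\<lambda>a. m i * int_col n B i a) (z i)"
    unfolding central_degrees_def mem_Collect_eq by metis
  \<comment> \<open>Orthogonality to the degree \<open>m i * int_col n B i\<close>, divided by
    \<open>m i\<close>. Taken at \<open>matvec n B r\<close>, this is the vanishing of the twisted
    \<open>K_i\<close>.\<close>
  have col_zero: "(\<Sum>a<n. sv (of_int (B a i)) (rK r a v)) = 0" if "i < k" "zvec n r" for i r v
  proof -
    have "sv (of_int (m i)) (\<Sum>a<n. sv (of_int (B a i)) (rK r a v)) =
        (\<Sum>a<n. sv (of_int (m i * int_col n B i a)) (rK r a v))"
      unfolding V.scale_sum_right by (intro sum.cong) (auto simp: int_col_def)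
    also have "\<dots> = 0" by (rule central_degree_orthogonal[OF m_degree[OF that(1)] that(2)])
    finally show ?thesis using m_pos[OF that(1)] by simp
  qed
  let ?C = "mat_inv_int n B"
  have BC: "inverse_int_mat n B ?C" by (rule inverse_mat_inv_int[OF B])
  have "k < n"
  proof (rule ccontr)
    \<comment> \<open>If all \<open>n\<close> columns are orthogonal to the charges, invertibility
      of \<open>B\<close> makes every charge zero; then \<open>L\<close> is empty and
      \<open>k = 0\<close>, against \<open>k = n \<ge> 2\<close>.\<close>
    assume "\<not> k < n"
    then have kn: "k = n" using k by simp
    have "rK r a v = 0" if "zvec n r" "a < n" for r a v
    proof -
      have "0 = (\<Sum>i<n. sv (of_int (?C i a)) (\<Sum>b<n. sv (of_int (B b i)) (rK r b v)))"
        using col_zero that kn by simp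
      also have "\<dots> = (\<Sum>i<n. \<Sum>b<n. sv (of_int (B b i * ?C i a)) (rK r b v))"
        by (simp add: V.scale_sum_right mult.commute)
      also have "\<dots> = (\<Sum>b<n. sv (of_int (\<Sum>i<n. B b i * ?C i a)) (rK r b v))"
        by (subst sum.swap) (simp add: V.scale_sum_left)
      also have "\<dots> = (\<Sum>b<n. if b = a then rK r b v else 0)"
        using BC that(2) unfolding inverse_int_mat_def by (intro sum.cong refl) simp
      finally show ?thesis using that(2) by simp
    qed
    then have "L = {}" unfolding L supp_def by auto
    then have "k = 0" using span_dim_adapted_basis[OF B, of 0 "{}"] by (simp add: k_def)
    then show False using n2 kn by simp
  qed
  have deg: "matvec n ?C (\<lambda>a. m i * int_col n B i a) = (\<lambda>j. if j = i then m i else 0)" if "i < k" for i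
    using mat_inv_int_col[OF B, of i _ "m i"] that k by (auto simp: matvec_def)
  have central_z: "central_op n sv (tw_g n B rg) (tw_K n B sv rK) (tw_d n B sv rd)
      (\<lambda>j. if j = i then m i else 0) (z i)" if "i < k" for i
    using central_op_twist[of "\<lambda>a. m i * int_col n B i a" "z i" B] z[OF that] unfolding deg[OF that] bicentral_def
    by blast
  have z_nonzero: "\<exists>v. z i v \<noteq> 0" if "i < k" for i
  proof -
    obtain v :: 'v where "v \<noteq> 0" by (rule nonzero_weight_vector)
    moreover have "surj (z i)" using z[OF that] unfolding bicentral_def by (simp add: bij_is_surj)
    ultimately show ?thesis by (metis surj_def)
  qed
  have vanish: "tw_K n B sv rK r i v = 0" if "i < n" "zvec n r" "k \<le> j" "r j \<noteq> 0" for i j r v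
  proof -
    have "rK (matvec n B r) a v = 0" if "a < n" for a
    proof (rule ccontr)
      \<comment> \<open>The degree of a nonzero charge lies in \<open>H\<close>, so its coordinates
        from \<open>k\<close> on vanish; as \<open>B\<close> is invertible, these coordinates are
        \<open>r\<close> itself.\<close>
      assume "rK (matvec n B r) a v \<noteq> 0"
      then have "matvec n B r \<in> supp" unfolding supp_def using that by auto
      then have "matvec n B r \<in> H" using LH unfolding L by blast
      then obtain s where s: "\<forall>j\<ge>k. s j = 0" "matvec n B r = matvec n B s" using coord unfolding kl by blast
      have "zvec n s" using s(1) k by (auto simp: zvec_def)
      then have "r = s"
        using s(2) matvec_inverse[OF inverse_int_mat_sym[OF BC]] \<open>zvec n r\<close> by metis
      then show False using s(1) \<open>k \<le> j\<close> \<open>r j \<noteq> 0\<close> by blast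
    qed
    then show ?thesis unfolding tw_K_def by simp
  qed
  have first_zero: "tw_K n B sv rK r i v = 0" if "i < k" for i r v
    unfolding tw_K_def by (rule col_zero[OF that zvec_matvec])
  show ?thesis
    unfolding Let_def
  proof (intro exI[of _ B] conjI)
    show "\<exists>m z. \<forall>i<k. m i \<noteq> 0 \<and> (\<exists>v. z i v \<noteq> 0) \<and>
        central_op n sv (tw_g n B rg) (tw_K n B sv rK) (tw_d n B sv rd) (\<lambda>j. if j = i then m i else 0) (z i)"
      using m_pos z_nonzero central_z by (intro exI[of _ m] exI[of _ z]) fastforce
    show "\<forall>i<n. \<forall>r. zvec n r \<longrightarrow> (\<exists>j\<ge>k. j < n \<and> r j \<noteq> 0) \<longrightarrow> (\<forall>v. tw_K n B sv rK r i v = 0)"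
      using vanish by blast
    show "\<forall>i<k. \<forall>r. zvec n r \<longrightarrow> (\<forall>v. tw_K n B sv rK r i v = 0)"
      using first_zero by blast
  qed (fact B, fact \<open>k < n\<close>, rule graded_quotient[OF B k m_pos z])
qed

end
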